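(* Let $U$ be an open subset of $\mathbb{C}$ containing $0$. Let $A$ and $B$ be complex unital Banach algebras, and let $\pi : U \to \mathcal{B}(A,B)$ be an analytic map such that for every $\lambda \in U$ the value $\pi(\lambda)$ is a (unital, continuous) algebra homomorphism $A \to B$, and such that $\pi(0)$ is surjective. Suppose that for each $x \in \operatorname{Ker} \pi(0)$ the spectrum $\sigma(x)$ does not disconnect $\mathbb{C}$ (i.e. $\mathbb{C}\setminus\sigma(x)$ is connected). Let $q : U \to E(B)$ be an analytic map. Then there exist an open set $V \subset \mathbb{C}$ with $0 \in V \subset U$ and an analytic map $p : V \to E(A)$ such that $\pi(\lambda)p(\lambda) = q(\lambda)$ for each $\lambda \in V$.
   Context: All Banach algebras are over $\mathbb{C}$ and unital; all Banach algebra homomorphisms are continuous and preserve $1$. $\mathcal{B}(A,B)$ is the Banach space of bounded linear operators from $A$ to $B$ (with the operator norm). For a Banach algebra $A$, $E(A) = \{p \in A : p^2 = p\}$ is the set of idempotents. An analytic map into $E(A)$ (or $E(B)$) is an analytic map into the Banach space $A$ (or $B$) with values in that subset. $\sigma(x)$ denotes the spectrum of $x$; for $x \in \operatorname{Ker}\pi(0) \subset A$ it is taken with respect to $A$. *)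

theory Defs
  imports "HOL-Analysis.Bounded_Linear_Function"
begin

class scaleC = scaleR +
  fixes scaleC :: "complex \<Rightarrow> 'a \<Rightarrow> 'a"  (infixr \<open>*\<^sub>C\<close> 75)
  assumes scaleR_scaleC: "r *\<^sub>R x = complex_of_real r *\<^sub>C x"

class complex_normed_vector = real_normed_vector + scaleC +
  assumes scaleC_add_right: "c *\<^sub>C (x + y) = c *\<^sub>C x + c *\<^sub>C y"
    and scaleC_add_left: "(c + d) *\<^sub>C x = c *\<^sub>C x + d *\<^sub>C x"
    and scaleC_scaleC: "c *\<^sub>C (d *\<^sub>C x) = (c * d) *\<^sub>C x"
    and norm_scaleC: "norm (c *\<^sub>C x) = cmod c * norm x"

class complex_banach = complex_normed_vector + banach

(* Unital complex Banach algebras.  Going through monoid_mult rather than real_normed_algebra_1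
   requires only a submultiplicative norm: neither norm 1 = 1 nor 0 \<noteq> 1 is assumed. *)
class complex_banach_algebra = complex_banach + real_normed_algebra + monoid_mult +
  assumes mult_scaleC_left: "(c *\<^sub>C x) * y = c *\<^sub>C (x * y)"
    and mult_scaleC_right: "x * (c *\<^sub>C y) = c *\<^sub>C (x * y)"

instantiation complex :: complex_banach_algebra
begin

definition scaleC_complex :: "complex \<Rightarrow> complex \<Rightarrow> complex" where
  "scaleC_complex c x = c * x"

instance
  by standard (simp_all add: scaleC_complex_def scaleR_conv_of_real algebra_simps norm_mult)

end

lemma bounded_linear_scaleC: "bounded_linear (\<lambda>x::'a::complex_normed_vector. c *\<^sub>C x)"
proof (rule bounded_linear_intro)
  fix x y :: 'a and r :: real
  show "c *\<^sub>C (x + y) = c *\<^sub>C x + c *\<^sub>C y"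
    by (rule scaleC_add_right)
  show "c *\<^sub>C (r *\<^sub>R x) = r *\<^sub>R (c *\<^sub>C x)"
    by (simp only: scaleR_scaleC scaleC_scaleC mult.commute)
  show "norm (c *\<^sub>C x) \<le> norm x * cmod c"
    by (simp add: norm_scaleC)
qed

(* The type of bounded operators consists of the real-linear ones.  When the codomain is complex it
   is a complex Banach space under pointwise scaling and the operator norm, and the complex-linear
   operators form a closed complex subspace of it. *)
instantiation blinfun :: (real_normed_vector, complex_normed_vector) complex_normed_vector
begin

lift_definition scaleC_blinfun :: "complex \<Rightarrow> 'a \<Rightarrow>\<^sub>L 'b \<Rightarrow> 'a \<Rightarrow>\<^sub>L 'b"
  is "\<lambda>c f x. c *\<^sub>C f x"
  by (rule bounded_linear_compose[OF bounded_linear_scaleC])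

instance
proof
  fix r :: real and c d :: complex and f g :: "'a \<Rightarrow>\<^sub>L 'b"
  show "r *\<^sub>R f = complex_of_real r *\<^sub>C f"
    by transfer (simp add: scaleR_scaleC)
  show "c *\<^sub>C (f + g) = c *\<^sub>C f + c *\<^sub>C g"
    by transfer (simp add: scaleC_add_right)
  show "(c + d) *\<^sub>C f = c *\<^sub>C f + d *\<^sub>C f"
    by transfer (simp add: scaleC_add_left)
  show "c *\<^sub>C (d *\<^sub>C f) = (c * d) *\<^sub>C f"
    by transfer (simp add: scaleC_scaleC)
  have le: "norm (a *\<^sub>C h) \<le> cmod a * norm h" for a and h :: "'a \<Rightarrow>\<^sub>L 'b"
  proof (rule norm_blinfun_bound)
    fix x
    have "norm (blinfun_apply h x) \<le> norm h * norm x"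
      by (rule norm_blinfun)
    then show "norm (blinfun_apply (a *\<^sub>C h) x) \<le> cmod a * norm h * norm x"
      by (simp add: scaleC_blinfun.rep_eq norm_scaleC mult.assoc mult_left_mono)
  qed simp
  show "norm (c *\<^sub>C f) = cmod c * norm f"
  proof (cases "c = 0")
    case True
    then show ?thesis
      using le[of c f] by simp
  next
    case False
    have "1 *\<^sub>C x = x" for x :: 'b
      using scaleR_scaleC[of 1 x] by simp
    then have "1 *\<^sub>C f = f"
      by transfer simp
    moreover have "inverse c *\<^sub>C (c *\<^sub>C f) = (inverse c * c) *\<^sub>C f"
      by transfer (simp only: scaleC_scaleC)
    ultimately have "inverse c *\<^sub>C (c *\<^sub>C f) = f"
      using False by simp
    then have "norm f \<le> inverse (cmod c) * norm (c *\<^sub>C f)"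
      using le[of "inverse c" "c *\<^sub>C f"] by (simp add: norm_inverse)
    then have "cmod c * norm f \<le> norm (c *\<^sub>C f)"
      using False by (simp add: field_simps)
    then show ?thesis
      using le[of c f] by simp
  qed
qed

end

instance blinfun :: (real_normed_vector, complex_banach) complex_banach ..

definition analytic_map_on :: "(complex \<Rightarrow> 'a::complex_banach) \<Rightarrow> complex set \<Rightarrow> bool" where
  "analytic_map_on f U \<longleftrightarrow>
    (\<forall>z\<in>U. \<exists>r>0. \<exists>a. \<forall>w\<in>ball z r. (\<lambda>n. (w - z) ^ n *\<^sub>C a n) sums f w)"

definition algebra_hom :: "('a::complex_banach_algebra \<Rightarrow> 'b::complex_banach_algebra) \<Rightarrow> bool" where
  "algebra_hom f \<longleftrightarrow>
    (\<forall>x y. f (x + y) = f x + f y) \<and>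
    (\<forall>c x. f (c *\<^sub>C x) = c *\<^sub>C f x) \<and>
    (\<forall>x y. f (x * y) = f x * f y) \<and>
    f 1 = 1"

definition idempotents :: "'a::complex_banach_algebra set" where
  "idempotents = {p. p * p = p}"

definition spectrum :: "'a::complex_banach_algebra \<Rightarrow> complex set" where
  "spectrum x = {z. \<not> (\<exists>y. (z *\<^sub>C 1 - x) * y = 1 \<and> y * (z *\<^sub>C 1 - x) = 1)}"

end

theory Submission
  imports Defs "HOL-Analysis.Analysis" "HOL-Computational_Algebra.Formal_Power_Series"
begin

text \<open>Idempotents p correspond to involutions 2 p - 1, so one lifts u = 2 q - 1.

At the point 0, let v be any lift of u (0) and J the kernel of pi (0). Elements of J have spectra
without interior: otherwise a suitable polynomial in such an element would again lie in J and have a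
spectrum surrounding a point of its complement. Hence the spectrum of v has no interior either, and
v can be changed modulo J to become invertible. Then w = v^2 is invertible, congruent to 1 modulo J,
and 0 lies in the connected set of all z such that w - z is invertible; a square root of w - z that
is a scalar modulo J can be continued from large z to z = 0. Dividing v by the root of w gives an
involution lifting u (0).

The open mapping theorem lets one solve pi (z) v (z) = u (z) recursively for the Taylor coefficients
of v, with geometric bounds and with that involution as v (0). The error y = v^2 - 1 vanishes at 0
and is killed by pi (z), so v (1 + y)^(-1/2) is an involution lifting u near 0.\<close>

section \<open>Complex scalar multiplication and powers\<close>

lemma scaleC_one [simp]: "1 *\<^sub>C x = (x::'a::complex_normed_vector)"
  using scaleR_scaleC[of 1 x] by simp

lemma bounded_bilinear_scaleC:
  "bounded_bilinear (scaleC :: complex \<Rightarrow> 'a::complex_normed_vector \<Rightarrow> 'a)"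
proof
  fix r :: real and c d :: complex and x y :: 'a
  show "(c + d) *\<^sub>C x = c *\<^sub>C x + d *\<^sub>C x" "c *\<^sub>C (x + y) = c *\<^sub>C x + c *\<^sub>C y"
    by (rule scaleC_add_left scaleC_add_right)+
  show "(r *\<^sub>R c) *\<^sub>C x = r *\<^sub>R (c *\<^sub>C x)" "c *\<^sub>C (r *\<^sub>R x) = r *\<^sub>R (c *\<^sub>C x)"
    by (simp_all add: scaleR_scaleC scaleC_scaleC scaleC_complex_def mult.commute scaleR_conv_of_real)
  show "\<exists>K. \<forall>(c::complex) (x::'a). norm (c *\<^sub>C x) \<le> norm c * norm x * K"
    by (intro exI[of _ 1]) (simp add: norm_scaleC)
qed

lemmas scaleC_zero_left [simp] = bounded_bilinear.zero_left[OF bounded_bilinear_scaleC]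
  and scaleC_zero_right [simp] = bounded_bilinear.zero_right[OF bounded_bilinear_scaleC]
  and scaleC_minus_left = bounded_bilinear.minus_left[OF bounded_bilinear_scaleC]
  and scaleC_minus_right = bounded_bilinear.minus_right[OF bounded_bilinear_scaleC]
  and scaleC_diff_left = bounded_bilinear.diff_left[OF bounded_bilinear_scaleC]
  and scaleC_diff_right = bounded_bilinear.diff_right[OF bounded_bilinear_scaleC]

lemmas scaleC_simps = scaleC_add_left scaleC_add_right scaleC_minus_left scaleC_minus_right
  scaleC_diff_left scaleC_diff_right scaleC_scaleC mult_scaleC_left mult_scaleC_right

text \<open>The factor \<open>norm 1\<close> is needed for the zeroth power, since the norm of the
  unit is not assumed to be 1.\<close>

lemma norm_power_le:
  "norm (y ^ n) \<le> norm (1::'a) * norm y ^ n" for y :: "'a::complex_banach_algebra"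
proof (induction n)
  case (Suc n)
  have "norm (y ^ Suc n) \<le> norm y * norm (y ^ n)"
    by (simp add: norm_mult_ineq)
  also have "\<dots> \<le> norm y * (norm (1::'a) * norm y ^ n)"
    by (intro mult_left_mono Suc) simp
  finally show ?case by (simp add: mult_ac)
qed simp

lemma power_scaleC: "(c *\<^sub>C y) ^ n = c ^ n *\<^sub>C y ^ n" for y :: "'a::complex_banach_algebra"
  by (induction n) (simp_all add: scaleC_simps mult.commute)

lemma power_zero_ring: "(0::'a::complex_banach_algebra) ^ n = (if n = 0 then 1 else 0)"
  by (cases n) auto

subsection \<open>Binomial series in a Banach algebra\<close>

text \<open>This is the power (1 + y)^a. The exponents that matter are 1, -1 (the inverse), 1/2 and
  -1/2 (the square root and its inverse).\<close>

definition binomial_series :: "real \<Rightarrow> 'a::complex_banach_algebra \<Rightarrow> 'a" where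
  "binomial_series a y = (\<Sum>n. (a gchoose n) *\<^sub>R y ^ n)"

text \<open>Consecutive coefficients have the ratio (a - n) / (n + 1), whose modulus is at most 1.
  Hence the geometric series in \<open>norm y\<close> dominates the binomial series.\<close>

lemma abs_gbinomial_le_1:
  fixes a :: real
  assumes "\<bar>a\<bar> \<le> 1"
  shows "\<bar>a gchoose n\<bar> \<le> 1"
proof (induction n)
  case (Suc n)
  have eq: "real (Suc n) * (a gchoose Suc n) = (a - real n) * (a gchoose n)"
    using gbinomial_mult_1[of a n] by (simp add: algebra_simps)
  have "real (Suc n) * \<bar>a gchoose Suc n\<bar> = \<bar>a - real n\<bar> * \<bar>a gchoose n\<bar>"
    using arg_cong[OF eq, of abs] by (simp add: abs_mult)
  also have "\<dots> \<le> real (Suc n) * 1"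
    using assms Suc by (intro mult_mono) auto
  finally show ?case
    by (simp del: of_nat_Suc)
qed simp

context
  fixes y :: "'a::complex_banach_algebra"
  assumes y: "norm y < 1"
begin

lemma summable_norm_binomial_series:
  assumes "\<bar>a\<bar> \<le> 1"
  shows "summable (\<lambda>n. norm ((a gchoose n) *\<^sub>R y ^ n))"
proof (rule summable_comparison_test'[of "\<lambda>n. norm (1::'a) * norm y ^ n" 0])
  show "summable (\<lambda>n. norm (1::'a) * norm y ^ n)"
    using y by (intro summable_mult summable_geometric) simp
  show "norm (norm ((a gchoose n) *\<^sub>R y ^ n)) \<le> norm (1::'a) * norm y ^ n" for n
    using mult_mono[OF abs_gbinomial_le_1[OF assms, of n] norm_power_le[of y n]] by simp
qed

lemma binomial_series_sums: "\<bar>a\<bar> \<le> 1 \<Longrightarrow> (\<lambda>n. (a gchoose n) *\<^sub>R y ^ n) sums binomial_series a y"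
  unfolding binomial_series_def using summable_norm_cancel[OF summable_norm_binomial_series] summable_sums by blast

text \<open>Cauchy product of two absolutely convergent series, with the coefficients collected by
  Vandermonde's identity.\<close>

lemma binomial_series_mult:
  assumes "\<bar>a\<bar> \<le> 1" "\<bar>b\<bar> \<le> 1"
  shows "binomial_series a y * binomial_series b y = binomial_series (a + b) y"
proof -
  have "(\<Sum>i\<le>n. ((a gchoose i) *\<^sub>R y ^ i) * ((b gchoose (n - i)) *\<^sub>R y ^ (n - i)))
      = ((a + b) gchoose n) *\<^sub>R y ^ n" for n
  proof -
    have "(\<Sum>i\<le>n. ((a gchoose i) *\<^sub>R y ^ i) * ((b gchoose (n - i)) *\<^sub>R y ^ (n - i)))
        = (\<Sum>i\<le>n. ((a gchoose i) * (b gchoose (n - i))) *\<^sub>R y ^ n)"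
      by (intro sum.cong) (simp_all add: power_add[symmetric])
    also have "\<dots> = (\<Sum>i=0..n. (a gchoose i) * (b gchoose (n - i))) *\<^sub>R y ^ n"
      by (simp add: scaleR_sum_left atLeast0AtMost)
    finally show ?thesis by (simp only: gbinomial_Vandermonde)
  qed
  then show ?thesis
    using Cauchy_product[OF summable_norm_binomial_series[OF assms(1)] summable_norm_binomial_series[OF assms(2)]]
    by (simp add: binomial_series_def)
qed

lemma binomial_series_commute:
  assumes "z * y = y * z" "\<bar>a\<bar> \<le> 1"
  shows "z * binomial_series a y = binomial_series a y * z"
proof -
  have *: "z * y ^ n = y ^ n * z" for n
    by (induction n) (simp_all add: assms(1), metis mult.assoc assms(1))
  have "(\<lambda>n. z * ((a gchoose n) *\<^sub>R y ^ n)) sums (z * binomial_series a y)"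
    by (intro bounded_linear.sums[OF bounded_linear_mult_right] binomial_series_sums assms)
  moreover have "(\<lambda>n. ((a gchoose n) *\<^sub>R y ^ n) * z) sums (binomial_series a y * z)"
    by (intro bounded_linear.sums[OF bounded_linear_mult_left] binomial_series_sums assms)
  ultimately show ?thesis
    by (simp add: * sums_unique2)
qed

end

lemma binomial_series_0 [simp]: "binomial_series 0 y = 1"
proof -
  have "(\<lambda>n. (0 gchoose n) *\<^sub>R y ^ n) = (\<lambda>n. if n = 0 then 1 else 0)"
    by (auto simp: gbinomial_0_left)
  then show ?thesis using sums_single[of 0 "\<lambda>_. 1::'a"] unfolding binomial_series_def
    by (simp add: sums_iff)
qed

lemma binomial_series_at_0 [simp]: "binomial_series a 0 = 1"
proof -
  have "(\<lambda>n. (a gchoose n) *\<^sub>R (0::'a) ^ n) = (\<lambda>n. if n = 0 then 1 else 0)"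
    by (auto simp: power_zero_ring)
  then show ?thesis using sums_single[of 0 "\<lambda>_. 1::'a"] unfolding binomial_series_def
    by (simp add: sums_iff)
qed

lemma binomial_series_1 [simp]: "binomial_series 1 y = 1 + y"
proof -
  have g: "(1 gchoose n) = (if n \<le> 1 then 1 else 0 :: real)" for n
    using binomial_gbinomial[of 1 n, where 'a = real] by (cases n) (auto simp: le_Suc_eq binomial_eq_0)
  have "(\<lambda>n. ((1::real) gchoose n) *\<^sub>R y ^ n) sums (\<Sum>n\<in>{..1}. (1 gchoose n) *\<^sub>R y ^ n)"
    by (rule sums_finite) (auto simp: g)
  then show ?thesis unfolding binomial_series_def by (simp add: sums_iff)
qed

subsection \<open>Invertible elements and the spectrum\<close>

definition unit_element :: "'a::complex_banach_algebra \<Rightarrow> bool" where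
  "unit_element x \<longleftrightarrow> (\<exists>y. x * y = 1 \<and> y * x = 1)"

lemma spectrum_iff: "z \<in> spectrum x \<longleftrightarrow> \<not> unit_element (z *\<^sub>C 1 - x)"
  by (simp add: spectrum_def unit_element_def)

text \<open>The exponents 1 and -1 add up to 0, so \<open>binomial_series (-1) y\<close> is the
  inverse; it is the Neumann series.\<close>

lemma unit_element_one_plus:
  assumes "norm y < 1"
  shows "unit_element (1 + y)"
  unfolding unit_element_def using binomial_series_mult[OF assms, of "-1" 1] binomial_series_mult[OF assms, of 1 "-1"]
  by auto

lemma unit_element_mult:
  assumes "unit_element x" "unit_element y"
  shows "unit_element (x * y)"
proof -
  obtain x' y' where "x * x' = 1" "x' * x = 1" "y * y' = 1" "y' * y = 1"
    using assms unfolding unit_element_def by blast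
  then have "x * y * (y' * x') = 1" "y' * x' * (x * y) = 1"
    by (metis mult.assoc mult_1_left)+
  then show ?thesis unfolding unit_element_def by blast
qed

text \<open>Commutation turns an inverse of the product into a right and a left inverse of
  \<open>x\<close>, and these must coincide.\<close>

lemma unit_element_factor:
  assumes "unit_element (x * y)" "x * y = y * x"
  shows "unit_element x"
proof -
  obtain u where u: "x * y * u = 1" "u * (x * y) = 1"
    using assms unfolding unit_element_def by blast
  then have "x * (y * u) = 1" "u * y * x = 1"
    using assms(2) by (metis mult.assoc)+
  moreover from this have "u * y = y * u"
    by (metis mult.assoc mult_1_left mult_1_right)
  ultimately show ?thesis unfolding unit_element_def by metis
qed

lemma unit_element_scaleC:
  assumes "c \<noteq> 0" "unit_element x"
  shows "unit_element (c *\<^sub>C x)"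
proof -
  obtain y where "x * y = 1" "y * x = 1"
    using assms unfolding unit_element_def by blast
  then have "c *\<^sub>C x * (inverse c *\<^sub>C y) = 1" "inverse c *\<^sub>C y * (c *\<^sub>C x) = 1"
    using assms by (simp_all add: scaleC_simps)
  then show ?thesis unfolding unit_element_def by blast
qed

lemma not_in_spectrum_if_large:
  fixes x :: "'a::complex_banach_algebra"
  assumes "norm x < norm z"
  shows "z \<notin> spectrum x"
proof -
  have z: "z \<noteq> 0" using assms by auto
  have "z *\<^sub>C 1 - x = z *\<^sub>C (1 + (- inverse z) *\<^sub>C x)"
    using z by (simp add: scaleC_simps)
  moreover have "norm ((- inverse z) *\<^sub>C x) < 1"
    using assms z by (simp add: norm_scaleC inverse_eq_divide norm_divide field_simps)
  ultimately show ?thesis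
    using unit_element_scaleC[OF z unit_element_one_plus] by (simp add: spectrum_iff)
qed

lemma open_resolvent_set: "open (- spectrum x)"
  unfolding open_dist
proof safe
  fix z assume "z \<notin> spectrum x"
  then obtain y where y: "(z *\<^sub>C 1 - x) * y = 1" "y * (z *\<^sub>C 1 - x) = 1"
    unfolding spectrum_iff unit_element_def by blast
  show "\<exists>e>0. \<forall>w. dist w z < e \<longrightarrow> w \<in> - spectrum x"
  proof (intro exI conjI allI impI)
    \<comment> \<open>Adding 1 avoids having to show that \<open>y\<close> is nonzero, which fails
      in the zero algebra.\<close>
    show "0 < inverse (norm y + 1)" by (simp add: add_nonneg_pos)
    fix w assume w: "dist w z < inverse (norm y + 1)"
    have "norm ((w - z) *\<^sub>C y) = dist w z * norm y"
      by (simp add: norm_scaleC dist_norm)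
    also have "\<dots> \<le> dist w z * (norm y + 1)" by (intro mult_left_mono) auto
    also have "\<dots> < inverse (norm y + 1) * (norm y + 1)"
      by (intro mult_strict_right_mono w) (simp add: add_nonneg_pos)
    also have "\<dots> = 1"
      using norm_ge_zero[of y] by (intro left_inverse) linarith
    finally have "unit_element (1 + (w - z) *\<^sub>C y)" by (rule unit_element_one_plus)
    moreover have "w *\<^sub>C 1 - x = (z *\<^sub>C 1 - x) * (1 + (w - z) *\<^sub>C y)"
      by (simp only: distrib_left mult_scaleC_right y(1)) (simp add: scaleC_diff_left)
    moreover have "unit_element (z *\<^sub>C 1 - x)"
      using y unfolding unit_element_def by blast
    ultimately show "w \<in> - spectrum x"
      by (simp add: spectrum_iff unit_element_mult)
  qed
qed

lemma spectrum_add_scalar: "z + c \<in> spectrum (x + c *\<^sub>C 1) \<longleftrightarrow> z \<in> spectrum x"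
  by (simp add: spectrum_iff scaleC_add_left)

text \<open>One inclusion of the spectral mapping theorem: \<open>z *\<^sub>C 1 - x\<close> divides
  the corresponding difference of powers with a commuting cofactor, so it would be a unit if that
  difference were one.\<close>

lemma spectrum_power:
  fixes x :: "'a::complex_banach_algebra"
  assumes "z \<in> spectrum x"
  shows "z ^ n \<in> spectrum (x ^ n)"
proof -
  have "\<exists>s. z ^ n *\<^sub>C 1 - x ^ n = (z *\<^sub>C 1 - x) * s \<and> x * s = s * x"
  proof (induction n)
    case 0
    show ?case by (intro exI[of _ 0]) simp
  next
    case (Suc n)
    then obtain s where s: "z ^ n *\<^sub>C 1 - x ^ n = (z *\<^sub>C 1 - x) * s" "x * s = s * x" by blast
    have "z ^ Suc n *\<^sub>C 1 - x ^ Suc n = z *\<^sub>C (z ^ n *\<^sub>C 1 - x ^ n) + (z *\<^sub>C 1 - x) * x ^ n"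
      by (simp add: scaleC_simps algebra_simps)
    also have "\<dots> = (z *\<^sub>C 1 - x) * (z *\<^sub>C s + x ^ n)"
      by (simp add: s scaleC_simps algebra_simps)
    finally show ?case
      using s(2) by (intro exI[of _ "z *\<^sub>C s + x ^ n"])
        (simp add: scaleC_simps distrib_left distrib_right power_commutes)
  qed
  then obtain s where s: "z ^ n *\<^sub>C 1 - x ^ n = (z *\<^sub>C 1 - x) * s" "x * s = s * x" by blast
  have "(z *\<^sub>C 1 - x) * s = s * (z *\<^sub>C 1 - x)"
    using s(2) by (simp add: scaleC_simps algebra_simps)
  then show ?thesis
    using assms s(1) unit_element_factor by (metis spectrum_iff)
qed

subsection \<open>Algebra homomorphisms\<close>

context
  fixes f :: "'a::complex_banach_algebra \<Rightarrow> 'b::complex_banach_algebra"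
  assumes f: "algebra_hom f"
begin

lemma hom_add: "f (x + y) = f x + f y"
  and hom_scaleC: "f (c *\<^sub>C x) = c *\<^sub>C f x"
  and hom_mult: "f (x * y) = f x * f y"
  and hom_one: "f 1 = 1"
  using f by (auto simp: algebra_hom_def)

lemma hom_zero: "f 0 = 0"
  using hom_add[of 0 0] by simp

lemma hom_minus: "f (- x) = - f x"
  using hom_scaleC[of "-1" x] by (simp add: scaleC_minus_left)

lemma hom_diff: "f (x - y) = f x - f y"
  using hom_add[of x "- y"] by (simp add: hom_minus)

lemma hom_scaleR: "f (r *\<^sub>R x) = r *\<^sub>R f x"
  by (simp add: scaleR_scaleC hom_scaleC)

lemma hom_power: "f (x ^ n) = f x ^ n"
  by (induction n) (simp_all add: hom_one hom_mult)

lemmas hom_simps = hom_add hom_scaleC hom_mult hom_one hom_zero hom_minus hom_diff hom_scaleR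
  hom_power

lemma hom_binomial_series:
  assumes "continuous_on UNIV f" "norm y < 1" "\<bar>a\<bar> \<le> 1"
  shows "f (binomial_series a y) = binomial_series a (f y)"
proof -
  have "(\<lambda>n. f (\<Sum>i<n. (a gchoose i) *\<^sub>R y ^ i)) \<longlonglongrightarrow> f (binomial_series a y)"
    using binomial_series_sums[OF assms(2,3)] assms(1)
    by (intro continuous_on_tendsto_compose[of UNIV f]) (auto simp: sums_def)
  moreover have "f (\<Sum>i<n. (a gchoose i) *\<^sub>R y ^ i) = (\<Sum>i<n. (a gchoose i) *\<^sub>R f y ^ i)" for n
    by (induction n) (simp_all add: hom_simps)
  ultimately show ?thesis
    unfolding binomial_series_def by (simp add: sums_def[symmetric] sums_iff)
qed

text \<open>If the spectrum of x contained a disc, some power of a large translate of x would have a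
  spectrum containing a circle about 0 but not 0 itself.\<close>

lemma interior_spectrum_kernel:
  assumes conn: "\<And>y. f y = 0 \<Longrightarrow> connected (- spectrum y)" and x: "f x = 0"
  shows "interior (spectrum x) = {}"
proof (rule ccontr)
  assume "interior (spectrum x) \<noteq> {}"
  then obtain z0 r where r: "r > 0" and ball: "ball z0 r \<subseteq> spectrum x"
    by (metis all_not_in_conv mem_interior)
  \<comment> \<open>The translate \<open>x + m *\<^sub>C 1\<close> is a unit, and \<open>f\<close>
    maps it to the scalar \<open>m\<close>.\<close>
  define m where "m = complex_of_real (norm x + 1)"
  have m: "- m \<notin> spectrum x"
    by (rule not_in_spectrum_if_large) (simp add: m_def del: of_real_add)
  define \<zeta> where "\<zeta> = z0 + m"
  have \<zeta>: "\<zeta> \<noteq> 0"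
    using m ball r by (auto simp: \<zeta>_def add_eq_0_iff2 subset_iff)
  \<comment> \<open>For such \<open>N\<close> the arc of half-angle pi / N around \<zeta> stays in
    the disc of radius \<open>r\<close>. Every point of the circle of radius
    \<open>norm \<zeta> ^ N\<close> about 0 then has an \<open>N\<close>-th root in that
    disc.\<close>
  obtain N :: nat where "norm \<zeta> * pi / r < real N"
    using reals_Archimedean2 by blast
  moreover from this have N0: "N > 0"
    using r by (intro gr0I) (auto simp: divide_less_0_iff mult_less_0_iff)
  ultimately have N: "norm \<zeta> * pi / real N < r"
    using r by (simp add: field_simps)
  \<comment> \<open>Subtracting the scalar image of the power puts it back into the kernel, so the
    connectedness hypothesis applies.\<close>
  define y where "y = (x + m *\<^sub>C 1) ^ N + (- (m ^ N)) *\<^sub>C 1"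
  have "f y = 0"
    unfolding y_def by (simp add: hom_simps x power_scaleC scaleC_simps)
  then have conn_y: "connected (- spectrum y)" by (rule conn)
  have "0 \<notin> spectrum (x + m *\<^sub>C 1)"
    using m spectrum_add_scalar[of "-m" m x] by simp
  have unit_power: "unit_element (u ^ n)" if "unit_element u" for u :: 'a and n
    by (induction n) (auto simp: that unit_element_mult, auto simp: unit_element_def)
  have "unit_element (x + m *\<^sub>C 1)"
    using \<open>0 \<notin> spectrum (x + m *\<^sub>C 1)\<close> unit_element_scaleC[of "-1" "- (x + m *\<^sub>C 1)"]
    by (simp add: spectrum_iff scaleC_minus_left add.commute)
  then have "0 \<notin> spectrum ((x + m *\<^sub>C 1) ^ N)"
    using unit_element_scaleC[of "-1" "(x + m *\<^sub>C 1) ^ N"]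
    by (simp add: spectrum_iff unit_power scaleC_minus_left)
  then have in1: "- (m ^ N) \<notin> spectrum y"
    using spectrum_add_scalar[of 0 "- (m ^ N)" "(x + m *\<^sub>C 1) ^ N"] by (simp add: y_def)
  \<comment> \<open>A point outside the spectrum of \<open>y\<close> and, seen from
    \<open>- (m ^ N)\<close>, not inside the circle of radius
    \<open>norm \<zeta> ^ N\<close>.\<close>
  define L where "L = complex_of_real (norm y + 1 + norm \<zeta> ^ N + norm (m ^ N))"
  have nL: "norm L = norm y + 1 + norm \<zeta> ^ N + norm (m ^ N)"
    unfolding L_def by (simp only: norm_of_real) simp
  have in2: "L \<notin> spectrum y"
    by (rule not_in_spectrum_if_large) (simp add: nL add_pos_nonneg)
  have in2': "norm (L + m ^ N) \<ge> norm \<zeta> ^ N"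
    using norm_triangle_ineq2[of L "- (m ^ N)"] nL norm_ge_zero[of y]
    unfolding norm_minus_cancel diff_minus_eq_add by linarith
  \<comment> \<open>Intermediate values: the distance to \<open>- (m ^ N)\<close> is 0 at that point
    itself and at least \<open>norm \<zeta> ^ N\<close> at \<open>L\<close>. A connected complement
    of the spectrum must therefore meet the circle.\<close>
  have "connected ((\<lambda>w. norm (w + m ^ N)) ` (- spectrum y))"
    by (intro connected_continuous_image continuous_intros conn_y)
  then have "{norm (- (m ^ N) + m ^ N)..norm (L + m ^ N)} \<subseteq> (\<lambda>w. norm (w + m ^ N)) ` (- spectrum y)"
    using in1 in2 by (intro connected_contains_Icc imageI) auto
  then have "norm \<zeta> ^ N \<in> (\<lambda>w. norm (w + m ^ N)) ` (- spectrum y)"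
    using in2' by auto
  then obtain w where w: "w \<notin> spectrum y" "norm (w + m ^ N) = norm \<zeta> ^ N"
    by auto
  define \<phi> where "\<phi> = Arg ((w + m ^ N) / \<zeta> ^ N)"
  have "norm ((w + m ^ N) / \<zeta> ^ N) = 1"
    using w(2) \<zeta> by (simp add: norm_divide norm_power)
  then have "cis \<phi> = (w + m ^ N) / \<zeta> ^ N"
    unfolding \<phi>_def by (metis cis_Arg div_by_1 norm_zero of_real_1 sgn_eq zero_neq_one)
  then have root: "(\<zeta> * cis (\<phi> / N)) ^ N = w + m ^ N"
    using \<zeta> N0 by (simp add: power_mult_distrib Complex.DeMoivre)
  have "dist \<zeta> (\<zeta> * cis (\<phi> / N)) = norm \<zeta> * norm (exp (\<i> * of_real (\<phi> / N)) - 1)"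
    by (simp add: dist_norm norm_minus_commute cis_conv_exp norm_mult[symmetric] algebra_simps)
  also have "\<dots> \<le> norm \<zeta> * \<bar>\<phi> / N\<bar>"
    using abs_sin_x_le_abs_x[of "\<phi> / N / 2"]
    by (intro mult_left_mono) (simp_all only: dist_exp_i_1 norm_ge_zero, simp)
  also have "\<dots> \<le> norm \<zeta> * (pi / N)"
    using Arg_bounded[of "(w + m ^ N) / \<zeta> ^ N"] unfolding \<phi>_def[symmetric]
    by (intro mult_left_mono) (auto simp: abs_le_iff divide_right_mono)
  finally have "\<zeta> * cis (\<phi> / N) - m \<in> ball z0 r"
    using N by (simp add: dist_norm \<zeta>_def algebra_simps)
  then have "\<zeta> * cis (\<phi> / N) \<in> spectrum (x + m *\<^sub>C 1)"
    using ball spectrum_add_scalar[of "\<zeta> * cis (\<phi> / N) - m" m x] by auto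
  then have "w + m ^ N \<in> spectrum ((x + m *\<^sub>C 1) ^ N)"
    using spectrum_power root by metis
  then have "w \<in> spectrum y"
    using spectrum_add_scalar[of "w + m ^ N" "- (m ^ N)" "(x + m *\<^sub>C 1) ^ N"] by (simp add: y_def)
  with w(1) show False ..
qed

text \<open>The element \<open>v ^ 2 - 1\<close> lies in the kernel. A disc in the spectrum of
  \<open>v\<close> would give one in the spectrum of that element, since squaring is locally
  invertible away from 0.\<close>

lemma interior_spectrum_lift:
  assumes conn: "\<And>y. f y = 0 \<Longrightarrow> connected (- spectrum y)" and v: "f v * f v = 1"
  shows "interior (spectrum v) = {}"
proof (rule ccontr)
  assume "interior (spectrum v) \<noteq> {}"
  moreover have "\<not> interior (spectrum v) \<subseteq> {0}" if "interior (spectrum v) \<noteq> {}"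
    using that by (metis not_open_singleton open_interior subset_singletonD)
  ultimately obtain z where z: "z \<in> interior (spectrum v)" "z \<noteq> 0" by blast
  then obtain r where r: "r > 0" and ball: "ball z r \<subseteq> spectrum v"
    by (meson mem_interior)
  \<comment> \<open>A branch of the square root of w + 1 with value \<open>z\<close> at
    \<open>z\<^sup>2 - 1\<close>. Dividing by \<open>z\<^sup>2\<close> moves the argument of
    \<open>csqrt\<close> to 1, away from the cut.\<close>
  define g where "g w = z * csqrt ((w + 1) / z\<^sup>2)" for w
  have g0: "g (z\<^sup>2 - 1) = z" and g2: "g w ^ 2 = w + 1" for w
    using z by (simp_all add: g_def power_mult_distrib)
  have "isCont g (z\<^sup>2 - 1)"
    unfolding g_def using z by (intro continuous_intros isCont_csqrt') auto
  then obtain d where d: "d > 0" "\<And>w. dist w (z\<^sup>2 - 1) < d \<Longrightarrow> dist (g w) z < r"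
    using r unfolding continuous_at_eps_delta by (metis g0)
  have "ball (z\<^sup>2 - 1) d \<subseteq> spectrum (v ^ 2 + (- 1) *\<^sub>C 1)"
  proof
    fix w assume "w \<in> ball (z\<^sup>2 - 1) d"
    then have "g w \<in> spectrum v"
      using d ball by (auto simp: dist_commute)
    then have "w + 1 \<in> spectrum (v ^ 2)"
      using spectrum_power g2 by metis
    then show "w \<in> spectrum (v ^ 2 + (- 1) *\<^sub>C 1)"
      using spectrum_add_scalar[of "w + 1" "-1" "v ^ 2"] by simp
  qed
  moreover have "f (v ^ 2 + (- 1) *\<^sub>C 1) = 0"
    using v by (simp add: hom_simps power2_eq_square scaleC_minus_left)
  ultimately show False
    using interior_spectrum_kernel[OF conn] d(1)
    by (metis centre_in_ball empty_iff mem_interior)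
qed

end

section \<open>Lifting an involution through a single homomorphism\<close>

lemma commute_inverse:
  fixes x y z :: "'a::complex_banach_algebra"
  assumes "y * z = 1" "z * y = 1" "x * y = y * x"
  shows "x * z = z * x"
proof -
  have "x * z = z * (y * x) * z"
    using assms(2) by (metis mult.assoc mult_1_left)
  also have "\<dots> = z * x * (y * z)"
    by (simp add: assms(3)[symmetric] mult.assoc)
  finally show ?thesis by (simp add: assms(1))
qed

text \<open>Scaling the unit multiplies the modulus by a fixed positive factor, so the image of the
  complete complex plane is complete.\<close>

lemma closed_range_scalars:
  assumes "(1::'a::complex_banach_algebra) \<noteq> 0"
  shows "closed (range (\<lambda>c. c *\<^sub>C (1::'a)))"
proof -
  have "complete (range (\<lambda>c. c *\<^sub>C (1::'a)))"
    using assms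
    by (intro complete_isometric_image[of "norm (1::'a)"]
        bounded_bilinear.bounded_linear_left[OF bounded_bilinear_scaleC])
       (auto simp: norm_scaleC complete_UNIV)
  then show ?thesis by (rule complete_imp_closed)
qed

context
  fixes f :: "'a::complex_banach_algebra \<Rightarrow> 'b::complex_banach_algebra"
  assumes f: "algebra_hom f" and cont: "continuous_on UNIV f" and nontriv: "(1::'b) \<noteq> 0"
    and conn: "\<And>y. f y = 0 \<Longrightarrow> connected (- spectrum y)"
begin

text \<open>The partial sums are mapped to scalars, and the scalars form a closed set.\<close>

lemma hom_binomial_series_scalar:
  assumes "f y = c *\<^sub>C 1" "norm y < 1" "\<bar>a\<bar> \<le> 1"
  shows "\<exists>d. f (binomial_series a y) = d *\<^sub>C 1"
proof -
  have "(\<lambda>n. f (\<Sum>i<n. (a gchoose i) *\<^sub>R y ^ i)) \<longlonglongrightarrow> f (binomial_series a y)"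
    using binomial_series_sums[OF assms(2,3)] cont
    by (intro continuous_on_tendsto_compose[of UNIV f]) (auto simp: sums_def)
  moreover have "f (\<Sum>i<n. (a gchoose i) *\<^sub>R y ^ i) \<in> range (\<lambda>c. c *\<^sub>C 1)" for n
  proof -
    have "f (\<Sum>i<n. (a gchoose i) *\<^sub>R y ^ i) = (\<Sum>i<n. of_real (a gchoose i) * c ^ i) *\<^sub>C 1"
      by (induction n)
        (simp_all add: hom_simps[OF f] assms(1) power_scaleC scaleR_scaleC scaleC_simps)
    then show ?thesis by blast
  qed
  ultimately have "f (binomial_series a y) \<in> range (\<lambda>c. c *\<^sub>C 1)"
    using closed_range_scalars[OF nontriv] by (meson closed_sequentially)
  then show ?thesis by blast
qed

text \<open>The factors z - v and - 1 / z - v are chosen so that their product agrees with a nonzero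
  multiple of v modulo the kernel.\<close>

lemma lift_involution_unit:
  assumes v: "f v * f v = 1"
  shows "\<exists>v'. f v' = f v \<and> unit_element v'"
proof -
  have int: "interior (spectrum v) = {}"
    using interior_spectrum_lift[OF f conn v] .
  have not_sub: "\<not> G \<subseteq> spectrum v" if "open G" "G \<noteq> {}" for G
    using int interior_maximal[OF _ that(1), of "spectrum v"] that(2) by auto
  \<comment> \<open>Removing 0 makes the map w to -1 / w available on \<open>G\<close>; removing 1
    and -1 ensures that \<open>s\<close> below is nonzero.\<close>
  define G where "G = - spectrum v - {0, 1, -1}"
  have "open G"
    unfolding G_def by (intro open_Diff open_resolvent_set) (simp add: finite_imp_closed)
  have "- {0, 1, -1 :: complex} \<noteq> {}"
    by (metis Compl_empty_eq finite.emptyI finite.insertI finite_compl double_complement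
        infinite_UNIV_char_0)
  then have "G \<noteq> {}"
    using not_sub[of "- {0, 1, -1}"] by (auto simp: G_def finite_imp_closed open_Compl)
  then obtain z0 where z0: "z0 \<in> G" by blast
  \<comment> \<open>The map w to -1 / w is its own inverse, so the preimage of \<open>G\<close> is
    open and nonempty. The spectrum of \<open>v\<close> has empty interior and cannot cover
    it.\<close>
  have "open (- {0} \<inter> (\<lambda>w. - 1 / w) -` G)"
    using \<open>open G\<close> by (intro continuous_open_preimage continuous_intros) auto
  moreover have "- 1 / z0 \<in> - {0} \<inter> (\<lambda>w. - 1 / w) -` G"
    using z0 by (auto simp: G_def)
  ultimately obtain z where z: "z \<noteq> 0" "- 1 / z \<in> G" "z \<notin> spectrum v"
    using not_sub by blast
  define s where "s = z + - 1 / z"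
  have s: "s \<noteq> 0"
  proof
    assume "s = 0"
    then have "z\<^sup>2 = 1" using z(1) by (simp add: s_def field_simps power2_eq_square)
    then show False using z(2) by (auto simp: G_def power2_eq_1_iff)
  qed
  define e where "e = (z *\<^sub>C 1 - v) * ((- 1 / z) *\<^sub>C 1 - v)"
  have "unit_element e"
    unfolding e_def using z(2,3) by (intro unit_element_mult) (auto simp: spectrum_iff G_def)
  moreover have "f e = - s *\<^sub>C f v"
    using z(1) v unfolding e_def s_def
    by (simp add: hom_simps[OF f] algebra_simps scaleC_simps)
  ultimately show ?thesis
    using s unit_element_scaleC[of "- 1 / s" e] by (intro exI[of _ "(- 1 / s) *\<^sub>C e"])
      (simp add: hom_simps[OF f] scaleC_simps)
qed

text \<open>The existence of a suitable root of \<open>w - \<mu> *\<^sub>C 1\<close> is locally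
  constant in \<mu> on the connected complement of the spectrum, and it holds for one large \<mu>.
  Asking the root to commute with the commutant of \<open>w\<close> makes it commute with the
  binomial series that continue it.\<close>

lemma sqrt_of_unit:
  assumes w: "f w = 1" "unit_element w"
  shows "\<exists>s. s * s = w \<and> (\<forall>x. x * w = w * x \<longrightarrow> x * s = s * x) \<and> f s = 1"
proof -
  define P where "P \<mu> \<longleftrightarrow> (\<exists>s c. s * s = w - \<mu> *\<^sub>C 1 \<and> (\<forall>x. x * w = w * x \<longrightarrow> x * s = s * x)
    \<and> f s = c *\<^sub>C 1)" for \<mu>
  \<comment> \<open>The exponent \<open>a\<close> is 1/2 for the passage from \<mu> to a nearby
    point and -1/2 for the way back, with the same \<open>y\<close>.\<close>
  have step: "P \<mu>'"
    if P: "P \<mu>" and a: "\<bar>a\<bar> \<le> 1 / 2" and y: "norm y < 1" "f y = d *\<^sub>C 1"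
      and y_comm: "\<And>x. x * w = w * x \<Longrightarrow> x * y = y * x"
      and eq: "w - \<mu>' *\<^sub>C 1 = (w - \<mu> *\<^sub>C 1) * binomial_series (a + a) y" for \<mu> \<mu>' a y d
  proof -
    obtain s c where s: "s * s = w - \<mu> *\<^sub>C 1" "\<And>x. x * w = w * x \<Longrightarrow> x * s = s * x" "f s = c *\<^sub>C 1"
      using P unfolding P_def by blast
    have a1: "\<bar>a\<bar> \<le> 1" using a by simp
    have sy: "s * binomial_series a y = binomial_series a y * s"
      using s(2)[of w] y_comm[of s] by (intro binomial_series_commute y a1) simp
    obtain d' where d': "f (binomial_series a y) = d' *\<^sub>C 1"
      using hom_binomial_series_scalar[OF y(2,1) a1] by blast
    have "s * binomial_series a y * (s * binomial_series a y) = s * s * (binomial_series a y * binomial_series a y)"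
      using sy by (metis mult.assoc)
    also have "\<dots> = w - \<mu>' *\<^sub>C 1"
      using binomial_series_mult[OF y(1) a1 a1] by (simp add: s eq)
    finally have "s * binomial_series a y * (s * binomial_series a y) = w - \<mu>' *\<^sub>C 1" .
    moreover have "x * (s * binomial_series a y) = s * binomial_series a y * x" if "x * w = w * x" for x
      using s(2)[OF that] binomial_series_commute[OF y(1) y_comm[OF that] a1] by (metis mult.assoc)
    moreover have "f (s * binomial_series a y) = (c * d') *\<^sub>C 1"
      by (simp add: hom_simps[OF f] s d' scaleC_simps mult.commute)
    ultimately show ?thesis unfolding P_def by blast
  qed
  \<comment> \<open>The element \<open>w - 1\<close> lies in the kernel, so the complement of its
    spectrum is connected; translation by 1 transfers this to \<open>w\<close>.\<close>
  have spec: "- spectrum w = (\<lambda>z. z + 1) ` (- spectrum (w + (- 1) *\<^sub>C 1))"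
    using spectrum_add_scalar[of _ "- 1" w] by (force simp: image_iff intro: bexI[of _ "_ - 1"])
  have "connected (- spectrum w)"
    unfolding spec using w(1)
    by (intro connected_continuous_image continuous_intros conn)
       (simp add: hom_simps[OF f] scaleC_minus_left)
  moreover have "0 \<in> - spectrum w"
    using unit_element_scaleC[of "-1" w] w(2) by (simp add: spectrum_iff scaleC_minus_left)
  moreover define K where "K = complex_of_real (norm w + 1)"
  have nK: "norm K = norm w + 1"
    unfolding K_def by (simp only: norm_of_real) simp
  then have "K \<in> - spectrum w"
    by (simp add: not_in_spectrum_if_large)
  moreover have "\<forall>\<mu>\<in>- spectrum w. eventually (\<lambda>\<mu>'. P \<mu> = P \<mu>') (at \<mu> within (- spectrum w))"
  proof
    fix \<mu> assume "\<mu> \<in> - spectrum w"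
    then obtain r where r: "(\<mu> *\<^sub>C 1 - w) * r = 1" "r * (\<mu> *\<^sub>C 1 - w) = 1"
      by (auto simp: spectrum_def)
    \<comment> \<open>The resolvent is a scalar modulo the kernel, so the correction factors keep
      the image of the root scalar.\<close>
    have "(\<mu> - 1) *\<^sub>C f r = 1"
      using arg_cong[OF r(1), of f] by (simp add: hom_simps[OF f] w scaleC_simps left_diff_distrib)
    moreover from this have "\<mu> \<noteq> 1" using nontriv by auto
    ultimately have fr: "f r = inverse (\<mu> - 1) *\<^sub>C 1"
      by (metis scaleC_scaleC left_inverse right_minus_eq scaleC_one)
    have r_comm: "x * r = r * x" if "x * w = w * x" for x
      using that by (intro commute_inverse[OF r]) (simp add: algebra_simps scaleC_simps)
    have nr: "(w - \<mu> *\<^sub>C 1) * r = - 1"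
      using r(1) by (metis minus_diff_eq mult_minus_left)
    have "P \<mu> = P \<mu>'" if \<mu>': "dist \<mu>' \<mu> < inverse (norm r + 1)" for \<mu>'
    proof -
      define y where "y = (\<mu>' - \<mu>) *\<^sub>C r"
      have "norm y = dist \<mu>' \<mu> * norm r"
        by (simp add: y_def norm_scaleC dist_norm)
      also have "\<dots> \<le> dist \<mu>' \<mu> * (norm r + 1)" by (intro mult_left_mono) auto
      also have "\<dots> < inverse (norm r + 1) * (norm r + 1)"
        by (intro mult_strict_right_mono \<mu>') (simp add: add_nonneg_pos)
      also have "\<dots> = 1"
        using norm_ge_zero[of r] by (intro left_inverse) linarith
      finally have y: "norm y < 1" .
      have fy: "f y = ((\<mu>' - \<mu>) * inverse (\<mu> - 1)) *\<^sub>C 1"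
        by (simp add: y_def hom_simps[OF f] fr scaleC_scaleC)
      have y_comm: "x * y = y * x" if "x * w = w * x" for x
        by (simp add: y_def mult_scaleC_left mult_scaleC_right r_comm[OF that])
      have eq: "w - \<mu>' *\<^sub>C 1 = (w - \<mu> *\<^sub>C 1) * (1 + y)"
        unfolding y_def by (simp only: distrib_left mult_scaleC_right nr)
          (simp add: scaleC_minus_right scaleC_diff_left)
      have "(1 + y) * binomial_series (-1) y = 1"
        using binomial_series_mult[OF y, of 1 "-1"] by simp
      then have eq': "w - \<mu> *\<^sub>C 1 = (w - \<mu>' *\<^sub>C 1) * binomial_series (-1) y"
        unfolding eq mult.assoc by simp
      show ?thesis
      proof
        assume "P \<mu>"
        then show "P \<mu>'"
          by (rule step[of \<mu> "1/2" y _ \<mu>', OF _ _ y fy y_comm]) (simp_all add: eq)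
      next
        assume "P \<mu>'"
        then show "P \<mu>"
          by (rule step[of \<mu>' "- 1/2" y _ \<mu>, OF _ _ y fy y_comm]) (simp_all add: eq')
      qed
    qed
    moreover have "inverse (norm r + 1) > 0" by (simp add: add_nonneg_pos)
    ultimately show "eventually (\<lambda>\<mu>'. P \<mu> = P \<mu>') (at \<mu> within (- spectrum w))"
      unfolding eventually_at by blast
  qed
  ultimately have "P K = P 0"
    by (intro connected_local_const[of "- spectrum w" K 0 P])
  moreover have "P K"
  proof -
    have pos: "0 < 1 + norm w" by (simp add: add_pos_nonneg)
    have K: "K \<noteq> 0" using nK pos by auto
    \<comment> \<open>Starting point of the continuation: w - K = (-K)(1 - w / K), where the second
      factor has a binomial square root.\<close>
    define y where "y = (- inverse K) *\<^sub>C w"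
    have y: "norm y < 1"
      using nK pos by (simp add: y_def norm_scaleC inverse_eq_divide norm_divide divide_less_eq add.commute)
    have fy: "f y = (- inverse K) *\<^sub>C 1"
      by (simp add: y_def hom_simps[OF f] w)
    obtain d where d: "f (binomial_series (1/2) y) = d *\<^sub>C 1"
      using hom_binomial_series_scalar[OF fy y, of "1/2"] by auto
    let ?s = "csqrt (- K) *\<^sub>C binomial_series (1/2) y"
    have "?s * ?s = (csqrt (- K) * csqrt (- K)) *\<^sub>C (binomial_series (1/2) y * binomial_series (1/2) y)"
      by (simp add: scaleC_simps)
    also have "\<dots> = w - K *\<^sub>C 1"
      using binomial_series_mult[OF y, of "1/2" "1/2"] K
      by (simp add: power2_eq_square[symmetric] y_def scaleC_simps)
    finally have "?s * ?s = w - K *\<^sub>C 1" .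
    moreover have "x * ?s = ?s * x" if "x * w = w * x" for x
      using binomial_series_commute[OF y, of x "1/2"] that by (simp add: scaleC_simps y_def)
    moreover have "f ?s = (csqrt (- K) * d) *\<^sub>C 1"
      by (simp add: hom_simps[OF f] d scaleC_simps)
    ultimately show ?thesis unfolding P_def by blast
  qed
  ultimately have "P 0" by simp
  then obtain s c where s0: "s * s = w - 0 *\<^sub>C 1"
    and s_comm: "\<And>x. x * w = w * x \<Longrightarrow> x * s = s * x" and fs: "f s = c *\<^sub>C 1"
    unfolding P_def by blast
  have s: "s * s = w" using s0 by simp
  \<comment> \<open>As \<open>f s\<close> squares to 1 in a nonzero algebra, \<open>c\<close> is its
    own inverse; multiplying \<open>s\<close> by \<open>c\<close> normalises the image to 1 without
    changing the square.\<close>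
  have "(c * c) *\<^sub>C 1 = (1::'b)"
    using arg_cong[OF s, of f] by (simp add: hom_simps[OF f] fs w mult_scaleC_left mult_scaleC_right scaleC_scaleC)
  then have "norm ((c * c - 1) *\<^sub>C (1::'b)) = 0"
    by (simp add: scaleC_diff_left)
  then have "c * c = 1"
    using nontriv by (simp add: norm_scaleC)
  then have "c *\<^sub>C s * (c *\<^sub>C s) = w" "f (c *\<^sub>C s) = 1"
    by (simp_all add: mult_scaleC_left mult_scaleC_right scaleC_scaleC s fs hom_simps[OF f])
  moreover have "x * (c *\<^sub>C s) = c *\<^sub>C s * x" if "x * w = w * x" for x
    by (simp add: mult_scaleC_left mult_scaleC_right s_comm[OF that])
  ultimately show ?thesis by blast
qed

text \<open>A unit lift \<open>v1\<close> is divided by a root \<open>s\<close> of its square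
  \<open>w\<close>. The inverse of \<open>s\<close> is \<open>s * w'\<close>; it commutes with
  \<open>v1\<close> and is mapped to 1.\<close>

lemma lift_involution:
  assumes v: "f v * f v = 1"
  shows "\<exists>v'. f v' = f v \<and> v' * v' = 1"
proof -
  obtain v1 where v1: "f v1 = f v" "unit_element v1"
    using lift_involution_unit[OF v] by blast
  define w where "w = v1 * v1"
  have "f w = 1" using v v1 by (simp add: w_def hom_simps[OF f])
  have "unit_element w" using v1 by (simp add: w_def unit_element_mult)
  then obtain w' where w': "w * w' = 1" "w' * w = 1"
    unfolding unit_element_def by blast
  obtain s where s: "s * s = w" "\<And>x. x * w = w * x \<Longrightarrow> x * s = s * x" "f s = 1"
    using sqrt_of_unit[OF \<open>f w = 1\<close> \<open>unit_element w\<close>] by blast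
  have vw: "v1 * w = w * v1" by (simp add: w_def mult.assoc)
  have vs: "v1 * s = s * v1" using s(2)[OF vw] .
  have vw': "v1 * w' = w' * v1" using commute_inverse[OF w' vw] .
  have sw': "s * w' = w' * s" using commute_inverse[OF w'] s(2)[of w] by simp
  have fw': "f w' = 1"
    using arg_cong[OF w'(1), of f] \<open>f w = 1\<close> by (simp add: hom_simps[OF f])
  have vt: "v1 * (s * w') = s * w' * v1"
    by (simp add: mult.assoc[symmetric] vs) (simp add: mult.assoc vw')
  have "s * w' * (s * w') = s * (w' * s) * w'"
    by (simp add: mult.assoc)
  also have "\<dots> = (s * s) * w' * w'"
    by (simp add: mult.assoc sw'[symmetric])
  finally have tt: "s * w' * (s * w') = w'"
    by (simp add: s(1) w')
  have "v1 * (s * w') * (v1 * (s * w')) = v1 * (s * w' * v1) * (s * w')"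
    by (simp add: mult.assoc)
  also have "\<dots> = w * (s * w' * (s * w'))"
    by (simp only: vt[symmetric]) (simp add: w_def mult.assoc)
  also have "\<dots> = 1"
    by (simp add: tt w')
  finally show ?thesis
    using v1 s(3) fw' by (intro exI[of _ "v1 * (s * w')"]) (simp add: hom_simps[OF f])
qed

end

subsection \<open>The open mapping theorem\<close>

text \<open>By Baire's theorem the closure of the image of some ball contains a ball. Only the
  closure is controlled, so the equation is solved up to half the size of the right-hand
  side.\<close>

lemma open_mapping_approx:
  fixes f :: "'a::banach \<Rightarrow> 'b::banach"
  assumes f: "bounded_linear f" and surj: "surj f"
  shows "\<exists>K\<ge>0. \<forall>y. \<exists>x. norm x \<le> K * norm y \<and> norm (y - f x) \<le> norm y / 2"
proof -
  interpret bounded_linear f by (rule f)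
  define T where "T n = closure (f ` ball 0 (real (Suc n)))" for n
  have "(\<Union>n. T n) = UNIV"
  proof -
    have "y \<in> (\<Union>n. T n)" for y
    proof -
      obtain x where x: "y = f x" using surj by blast
      obtain n where "norm x < real n" using reals_Archimedean2 by blast
      then have "x \<in> ball 0 (real (Suc n))" by simp
      then have "y \<in> f ` ball 0 (real (Suc n))" using x by (intro image_eqI)
      then have "y \<in> T n" unfolding T_def by (rule subsetD[OF closure_subset])
      then show ?thesis by (rule UN_I[OF UNIV_I])
    qed
    then show ?thesis by blast
  qed
  then have "euclidean interior_of (\<Union>(range T)) \<noteq> {}"
    by simp
  moreover have "countable (range T)" by simp
  moreover have "closedin euclidean (T n)" for n
    by (simp add: T_def)
  ultimately obtain n y0 where "y0 \<in> euclidean interior_of T n"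
    using Baire_category_alt[of "euclidean :: 'b topology" "range T"] completely_metrizable_space_euclidean
    by blast
  then have "y0 \<in> interior (T n)"
    by simp
  then obtain e where e: "e > 0" "ball y0 e \<subseteq> T n"
    unfolding mem_interior by blast
  define R where "R = real (Suc n)"
  have R: "R > 0" by (simp add: R_def)
  \<comment> \<open>Approximating \<open>y0 + y\<close> and the centre \<open>y0\<close> and
    subtracting moves the ball to the origin; hence the bound \<open>2 * R\<close>.\<close>
  have approx: "\<exists>x. norm x < 2 * R \<and> norm (y - f x) < d" if "norm y < e" "d > 0" for y d
  proof -
    have "y0 + y \<in> T n" "y0 \<in> T n"
      using e that by (auto simp: subset_iff dist_norm)
    then have "\<exists>z\<in>f ` ball 0 R. dist z (y0 + y) < d / 2" "\<exists>z\<in>f ` ball 0 R. dist z y0 < d / 2"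
      using half_gt_zero[OF \<open>d > 0\<close>] unfolding T_def closure_approachable R_def[symmetric] by blast+
    then obtain x1 x2 where x: "norm x1 < R" "dist (f x1) (y0 + y) < d / 2"
        "norm x2 < R" "dist (f x2) y0 < d / 2"
      by auto
    have "norm (y - f (x1 - x2)) = norm ((f x2 - y0) - (f x1 - (y0 + y)))"
      by (simp add: diff algebra_simps)
    also have "\<dots> < d"
      using x norm_triangle_ineq4[of "f x2 - y0" "f x1 - (y0 + y)"] by (simp add: dist_norm)
    finally show ?thesis
      using x norm_triangle_ineq4[of x1 x2] by (intro exI[of _ "x1 - x2"]) simp
  qed
  show ?thesis
  proof (intro exI[of _ "4 * R / e"] conjI allI)
    show "0 \<le> 4 * R / e" using R e by simp
    fix y
    show "\<exists>x. norm x \<le> 4 * R / e * norm y \<and> norm (y - f x) \<le> norm y / 2"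
    proof (cases "y = 0")
      case True
      then show ?thesis by (intro exI[of _ 0]) simp
    next
      case False
      \<comment> \<open>Then \<open>t *\<^sub>R y\<close> has norm e / 2, and an error of e / 4
        becomes \<open>norm y / 2\<close> after scaling back.\<close>
      define t where "t = e / (2 * norm y)"
      have t: "t > 0" using False e by (simp add: t_def)
      have "norm (t *\<^sub>R y) < e" using False e by (simp add: t_def)
      then obtain x where x: "norm x < 2 * R" "norm (t *\<^sub>R y - f x) < e / 4"
        using approx[of "t *\<^sub>R y" "e / 4"] e by auto
      have "y - f (inverse t *\<^sub>R x) = inverse t *\<^sub>R (t *\<^sub>R y - f x)"
        using t by (simp add: scaleR scaleR_diff_right)
      then have "norm (y - f (inverse t *\<^sub>R x)) = inverse t * norm (t *\<^sub>R y - f x)"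
        using t by simp
      also have "\<dots> \<le> inverse t * (e / 4)"
        using t x by (intro mult_left_mono) auto
      also have "\<dots> = norm y / 2"
        using e by (simp add: t_def)
      finally have 1: "norm (y - f (inverse t *\<^sub>R x)) \<le> norm y / 2" .
      have "norm (inverse t *\<^sub>R x) \<le> inverse t * (2 * R)"
        using t x by (simp add: mult_left_mono)
      also have "\<dots> = 4 * R / e * norm y"
        by (simp add: t_def)
      finally show ?thesis using 1 by blast
    qed
  qed
qed

text \<open>Applying the approximate solution to the successive residuals \<open>r n\<close> halves
  them each time. The corrections form a geometrically convergent series, and the images telescope
  to \<open>y\<close>.\<close>

lemma open_mapping_bound:
  fixes f :: "'a::banach \<Rightarrow> 'b::banach"
  assumes f: "bounded_linear f" and surj: "surj f"
  shows "\<exists>C\<ge>0. \<forall>y. \<exists>x. f x = y \<and> norm x \<le> C * norm y"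
proof -
  interpret bounded_linear f by (rule f)
  obtain K where K: "K \<ge> 0" "\<And>y. \<exists>x. norm x \<le> K * norm y \<and> norm (y - f x) \<le> norm y / 2"
    using open_mapping_approx[OF assms] by blast
  then obtain g where g: "\<And>y. norm (g y) \<le> K * norm y" "\<And>y. norm (y - f (g y)) \<le> norm y / 2"
    by metis
  have "\<exists>x. f x = y \<and> norm x \<le> K * 2 * norm y" for y
  proof -
    define r where "r n = ((\<lambda>z. z - f (g z)) ^^ n) y" for n
    have r_Suc: "r (Suc n) = r n - f (g (r n))" and r_0: "r 0 = y" for n
      by (simp_all add: r_def)
    have r_le: "norm (r n) \<le> norm y * (1 / 2) ^ n" for n
    proof (induction n)
      case (Suc n)
      then show ?case using g(2)[of "r n"] by (simp add: r_Suc)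
    qed (simp add: r_0)
    have geo: "(\<lambda>n. K * (norm y * (1 / 2) ^ n)) sums (K * (norm y * 2))"
      using geometric_sums[of "1/2 :: real"] by (intro sums_mult) auto
    have g_le: "norm (g (r n)) \<le> K * (norm y * (1 / 2) ^ n)" for n
      using g(1)[of "r n"] mult_left_mono[OF r_le[of n] K(1)] by simp
    have sum_g: "summable (\<lambda>n. norm (g (r n)))"
      by (rule summable_comparison_test'[OF sums_summable[OF geo], of 0]) (simp add: g_le)
    have "r \<longlonglongrightarrow> 0"
    proof (rule Lim_null_comparison)
      show "\<forall>\<^sub>F n in sequentially. norm (r n) \<le> norm y * (1 / 2) ^ n"
        by (simp add: r_le)
      show "(\<lambda>n. norm y * (1 / 2) ^ n) \<longlonglongrightarrow> 0"
        by (intro tendsto_mult_right_zero LIMSEQ_power_zero) simp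
    qed
    then have "(\<lambda>n. r n - r (Suc n)) sums (r 0 - 0)"
      by (rule telescope_sums')
    then have "(\<lambda>n. f (g (r n))) sums y"
      by (simp add: r_Suc r_0)
    moreover have "(\<lambda>n. f (g (r n))) sums f (\<Sum>n. g (r n))"
      using summable_norm_cancel[OF sum_g] by (intro sums summable_sums)
    ultimately have "f (\<Sum>n. g (r n)) = y" by (rule sums_unique2[symmetric])
    moreover have "norm (\<Sum>n. g (r n)) \<le> (\<Sum>n. norm (g (r n)))"
      by (rule summable_norm[OF sum_g])
    moreover have "(\<Sum>n. norm (g (r n))) \<le> K * (norm y * 2)"
      using suminf_le[OF g_le sum_g sums_summable[OF geo]] sums_unique[OF geo] by simp
    ultimately show ?thesis by (intro exI[of _ "\<Sum>n. g (r n)"]) simp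
  qed
  then show ?thesis
    using K(1) by (intro exI[of _ "K * 2"]) auto
qed

subsection \<open>Absolutely convergent power series\<close>

text \<open>\<open>M\<close> bounds the majorant series on the closed disc. Keeping it explicit
  makes sums, products and infinite sums of such series controllable; outside the disc
  \<open>f\<close> is unconstrained.\<close>

definition aps :: "real \<Rightarrow> real \<Rightarrow> (nat \<Rightarrow> 'a::complex_banach) \<Rightarrow> (complex \<Rightarrow> 'a) \<Rightarrow> bool" where
  "aps r M a f \<longleftrightarrow> (\<forall>N. (\<Sum>n<N. norm (a n) * r ^ n) \<le> M) \<and>
    (\<forall>z. norm z \<le> r \<longrightarrow> (\<lambda>n. z ^ n *\<^sub>C a n) sums f z)"

lemma norm_power_term_le: "norm z \<le> r \<Longrightarrow> norm (z ^ n *\<^sub>C a) \<le> norm a * r ^ n"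
  for a :: "'a::complex_normed_vector"
  by (simp add: norm_scaleC norm_power mult.commute[of "norm a"] mult_right_mono power_mono)

lemma aps_sums: "aps r M a f \<Longrightarrow> norm z \<le> r \<Longrightarrow> (\<lambda>n. z ^ n *\<^sub>C a n) sums f z"
  by (simp add: aps_def)

lemma aps_bound: "aps r M a f \<Longrightarrow> (\<Sum>n<N. norm (a n) * r ^ n) \<le> M"
  by (simp add: aps_def)

lemma aps_weaken:
  assumes "aps r M a f" "M \<le> M'" "\<And>z. norm z \<le> r \<Longrightarrow> f z = g z"
  shows "aps r M' a g"
  using assms by (auto simp: aps_def intro: order_trans)

context
  fixes r :: real
  assumes r: "r > 0"
begin

lemma aps_nonneg: "aps r M a f \<Longrightarrow> 0 \<le> M"
  using aps_bound[of r M a f 0] by simp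

lemma aps_summable: "aps r M a f \<Longrightarrow> summable (\<lambda>n. norm (a n) * r ^ n)"
  using r by (intro summableI_nonneg_bounded[of _ M]) (auto simp: aps_bound)

lemma aps_suminf_le: "aps r M a f \<Longrightarrow> (\<Sum>n. norm (a n) * r ^ n) \<le> M"
  by (intro suminf_le_const aps_summable) (auto simp: aps_bound)

lemma apsI:
  fixes a :: "nat \<Rightarrow> 'a::complex_banach"
  assumes "\<And>N. (\<Sum>n<N. norm (a n) * r ^ n) \<le> M"
  shows "aps r M a (\<lambda>z. \<Sum>n. z ^ n *\<^sub>C a n)"
  unfolding aps_def
proof (intro conjI allI impI assms)
  fix z :: complex assume z: "norm z \<le> r"
  have "summable (\<lambda>n. norm (a n) * r ^ n)"
    using r by (intro summableI_nonneg_bounded[of _ M]) (auto simp: assms)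
  then have "summable (\<lambda>n. z ^ n *\<^sub>C a n)"
    by (rule summable_comparison_test'[of _ 0]) (simp add: norm_power_term_le z)
  then show "(\<lambda>n. z ^ n *\<^sub>C a n) sums (\<Sum>n. z ^ n *\<^sub>C a n)"
    by (rule summable_sums)
qed

lemma aps_norm_le:
  assumes "aps r M a f" "norm z \<le> r"
  shows "norm (f z) \<le> M"
proof -
  have le: "norm (z ^ n *\<^sub>C a n) \<le> norm (a n) * r ^ n" for n
    by (rule norm_power_term_le[OF assms(2)])
  have s: "summable (\<lambda>n. norm (z ^ n *\<^sub>C a n))"
    by (rule summable_comparison_test'[OF aps_summable[OF assms(1)], of 0]) (simp add: le)
  have "norm (f z) \<le> (\<Sum>n. norm (z ^ n *\<^sub>C a n))"
    using summable_norm[OF s] sums_unique[OF aps_sums[OF assms]] by simp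
  also have "\<dots> \<le> (\<Sum>n. norm (a n) * r ^ n)"
    by (intro suminf_le le s aps_summable[OF assms(1)])
  also have "\<dots> \<le> M" by (rule aps_suminf_le[OF assms(1)])
  finally show ?thesis .
qed

lemma aps_const: "aps r (norm c) (\<lambda>n. if n = 0 then c else 0) (\<lambda>_. c)"
proof -
  have "(\<Sum>n<N. norm (if n = 0 then c else 0) * r ^ n) \<le> norm c" for N
    by (cases N) (simp_all add: sum.lessThan_Suc_shift del: sum.lessThan_Suc)
  moreover have "(\<lambda>n. z ^ n *\<^sub>C (if n = 0 then c else 0)) sums c" for z :: complex
    using sums_single[of 0 "\<lambda>_. c"] by (simp add: if_distrib[of "\<lambda>x. _ *\<^sub>C x"] cong: if_cong)
  ultimately show ?thesis by (simp add: aps_def)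
qed

lemma aps_add:
  assumes "aps r M a f" "aps r N b g"
  shows "aps r (M + N) (\<lambda>n. a n + b n) (\<lambda>z. f z + g z)"
  unfolding aps_def
proof (intro conjI allI impI)
  fix K
  have "(\<Sum>n<K. norm (a n + b n) * r ^ n) \<le> (\<Sum>n<K. norm (a n) * r ^ n + norm (b n) * r ^ n)"
    using r by (intro sum_mono) (simp add: distrib_right[symmetric] mult_right_mono norm_triangle_ineq)
  also have "\<dots> \<le> M + N"
    using aps_bound[OF assms(1)] aps_bound[OF assms(2)] by (simp add: sum.distrib add_mono)
  finally show "(\<Sum>n<K. norm (a n + b n) * r ^ n) \<le> M + N" .
next
  fix z :: complex assume "norm z \<le> r"
  then show "(\<lambda>n. z ^ n *\<^sub>C (a n + b n)) sums (f z + g z)"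
    using sums_add[OF aps_sums[OF assms(1)] aps_sums[OF assms(2)]] by (simp add: scaleC_add_right)
qed

lemma aps_linear:
  assumes "aps r M a f" and h: "bounded_linear h" "\<And>c x. h (c *\<^sub>C x) = c *\<^sub>C h x"
    "\<And>x. norm (h x) \<le> K * norm x" "K \<ge> 0"
  shows "aps r (K * M) (\<lambda>n. h (a n)) (\<lambda>z. h (f z))"
  unfolding aps_def
proof (intro conjI allI impI)
  fix N
  have "(\<Sum>n<N. norm (h (a n)) * r ^ n) \<le> (\<Sum>n<N. (K * norm (a n)) * r ^ n)"
    using r by (intro sum_mono mult_right_mono h) simp
  also have "\<dots> = K * (\<Sum>n<N. norm (a n) * r ^ n)"
    by (simp add: sum_distrib_left mult.assoc)
  also have "\<dots> \<le> K * M"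
    by (intro mult_left_mono aps_bound[OF assms(1)] h)
  finally show "(\<Sum>n<N. norm (h (a n)) * r ^ n) \<le> K * M" .
next
  fix z :: complex assume "norm z \<le> r"
  then show "(\<lambda>n. z ^ n *\<^sub>C h (a n)) sums h (f z)"
    using bounded_linear.sums[OF h(1) aps_sums[OF assms(1)]] by (simp add: h(2))
qed

lemma aps_shift:
  assumes "aps r M a f"
  shows "aps r (M * r ^ j) (\<lambda>n. if n < j then 0 else a (n - j)) (\<lambda>z. z ^ j *\<^sub>C f z)"
  unfolding aps_def
proof (intro conjI allI impI)
  fix N
  let ?c = "\<lambda>n. norm (if n < j then 0 else a (n - j)) * r ^ n"
  have eq: "(\<Sum>n<N + j. ?c n) = (\<Sum>n<N. norm (a n) * r ^ n) * r ^ j" for N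
    by (induction N) (simp_all add: distrib_right power_add)
  have "(\<Sum>n<N. ?c n) \<le> (\<Sum>n<N + j. ?c n)"
    using r by (intro sum_mono2) auto
  also have "\<dots> \<le> M * r ^ j"
    unfolding eq using r aps_bound[OF assms] by (intro mult_right_mono) auto
  finally show "(\<Sum>n<N. ?c n) \<le> M * r ^ j" .
next
  fix z :: complex assume "norm z \<le> r"
  then have "(\<lambda>n. z ^ j *\<^sub>C (z ^ n *\<^sub>C a n)) sums (z ^ j *\<^sub>C f z)"
    by (intro bounded_linear.sums[OF bounded_linear_scaleC] aps_sums[OF assms])
  then have "(\<lambda>n. z ^ (n + j) *\<^sub>C (if n + j < j then 0 else a (n + j - j))) sums (z ^ j *\<^sub>C f z)"
    by (simp add: scaleC_scaleC power_add mult.commute)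
  then show "(\<lambda>n. z ^ n *\<^sub>C (if n < j then 0 else a (n - j))) sums (z ^ j *\<^sub>C f z)"
    by (subst (asm) sums_zero_iff_shift) auto
qed

text \<open>The bounds \<open>M k\<close> dominate all partial sums uniformly on the disc, so
  Tannery's theorem interchanges the two summations.\<close>

lemma aps_suminf:
  fixes a :: "nat \<Rightarrow> nat \<Rightarrow> 'a::complex_banach_algebra"
  assumes aps: "\<And>k. aps r (M k) (a k) (f k)" and M: "summable M"
  shows "aps r (suminf M) (\<lambda>n. \<Sum>k. a k n) (\<lambda>z. \<Sum>k. f k z)"
proof -
  have term_le: "norm (a k n) * r ^ n \<le> M k" for k n
  proof -
    have "norm (a k n) * r ^ n \<le> (\<Sum>i<Suc n. norm (a k i) * r ^ i)"
      using r by (intro member_le_sum) auto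
    then show ?thesis using aps_bound[OF aps] by (meson order_trans)
  qed
  have sn: "summable (\<lambda>k. norm (a k n) * r ^ n)" for n
    by (rule summable_comparison_test'[OF M, of 0]) (use r term_le in auto)
  have "(\<lambda>k. norm (a k n) * r ^ n * inverse (r ^ n)) = (\<lambda>k. norm (a k n))" for n
    using r by (simp add: fun_eq_iff)
  then have sna: "summable (\<lambda>k. norm (a k n))" for n
    using summable_mult2[OF sn[of n], of "inverse (r ^ n)"] by simp
  note sa = summable_norm_cancel[OF sna]
  show ?thesis
    unfolding aps_def
  proof (intro conjI allI impI)
    fix N
    have "(\<Sum>n<N. norm (\<Sum>k. a k n) * r ^ n) \<le> (\<Sum>n<N. (\<Sum>k. norm (a k n) * r ^ n))"
    proof (rule sum_mono)
      fix n
      have "norm (\<Sum>k. a k n) * r ^ n \<le> (\<Sum>k. norm (a k n)) * r ^ n"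
        using r by (intro mult_right_mono summable_norm sna) auto
      also have "\<dots> = (\<Sum>k. norm (a k n) * r ^ n)"
        by (rule suminf_mult2[OF sna])
      finally show "norm (\<Sum>k. a k n) * r ^ n \<le> (\<Sum>k. norm (a k n) * r ^ n)" .
    qed
    also have "\<dots> = (\<Sum>k. \<Sum>n<N. norm (a k n) * r ^ n)"
      by (intro suminf_sum[symmetric] sn)
    also have "\<dots> \<le> suminf M"
      by (intro suminf_le aps_bound[OF aps] summable_sum sn M)
    finally show "(\<Sum>n<N. norm (\<Sum>k. a k n) * r ^ n) \<le> suminf M" .
  next
    fix z :: complex assume z: "norm z \<le> r"
    have le: "norm (\<Sum>n<N. z ^ n *\<^sub>C a k n) \<le> M k" for k N
    proof -
      have "norm (\<Sum>n<N. z ^ n *\<^sub>C a k n) \<le> (\<Sum>n<N. norm (a k n) * r ^ n)"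
        by (intro sum_norm_le norm_power_term_le z)
      then show ?thesis using aps_bound[OF aps] by (meson order_trans)
    qed
    have "(\<lambda>N. \<Sum>k. \<Sum>n<N. z ^ n *\<^sub>C a k n) \<longlonglongrightarrow> (\<Sum>k. f k z)"
      using tannerys_theorem[of "\<lambda>k N. \<Sum>n<N. z ^ n *\<^sub>C a k n" "\<lambda>k. f k z" sequentially M]
        aps_sums[OF aps z] M le
      by (auto simp: sums_def case_prod_unfold)
    moreover have "(\<Sum>k. \<Sum>n<N. z ^ n *\<^sub>C a k n) = (\<Sum>n<N. z ^ n *\<^sub>C (\<Sum>k. a k n))" for N
    proof -
      have "(\<Sum>k. \<Sum>n<N. z ^ n *\<^sub>C a k n) = (\<Sum>n<N. \<Sum>k. z ^ n *\<^sub>C a k n)"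
        by (intro suminf_sum bounded_linear.summable[OF bounded_linear_scaleC] sa)
      also have "\<dots> = (\<Sum>n<N. z ^ n *\<^sub>C (\<Sum>k. a k n))"
        by (intro sum.cong refl bounded_linear.suminf[OF bounded_linear_scaleC sa, symmetric])
      finally show ?thesis .
    qed
    ultimately show "(\<lambda>n. z ^ n *\<^sub>C (\<Sum>k. a k n)) sums (\<Sum>k. f k z)"
      by (simp add: sums_def)
  qed
qed

text \<open>Homogeneity in the second argument is only required at the values of f: the coefficients of
  an analytic family of complex-linear operators are a priori merely real-linear.\<close>

lemma aps_prod:
  fixes prod :: "'a::complex_banach \<Rightarrow> 'b::complex_banach \<Rightarrow> 'c::complex_banach_algebra"
  assumes f: "aps r M a f" and g: "aps r N b g" and bil: "bounded_bilinear prod"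
    and norm_prod: "\<And>x y. norm (prod x y) \<le> norm x * norm y"
    and hom1: "\<And>c x y. prod (c *\<^sub>C x) y = c *\<^sub>C prod x y"
    and hom2: "\<And>z c y. norm z \<le> r \<Longrightarrow> prod (f z) (c *\<^sub>C y) = c *\<^sub>C prod (f z) y"
  shows "aps r (M * N) (\<lambda>n. \<Sum>j\<le>n. prod (a (n - j)) (b j)) (\<lambda>z. prod (f z) (g z))"
proof -
  \<comment> \<open>The product is the sum over \<open>j\<close> of z^j times
    \<open>prod (f z) (b j)\<close>; each summand is a shifted linear image of
    \<open>f\<close>.\<close>
  let ?M = "\<lambda>j. norm (b j) * M * r ^ j"
  have 1: "aps r (?M j) (\<lambda>n. if n < j then 0 else prod (a (n - j)) (b j))
      (\<lambda>z. z ^ j *\<^sub>C prod (f z) (b j))" for j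
    using norm_prod
    by (intro aps_shift aps_linear[OF f] bounded_bilinear.bounded_linear_left[OF bil] hom1)
       (auto simp: mult.commute)
  have M: "?M = (\<lambda>j. M * (norm (b j) * r ^ j))" by (simp add: mult_ac)
  have 2: "summable ?M"
    unfolding M by (intro summable_mult aps_summable[OF g])
  have "suminf ?M = M * (\<Sum>j. norm (b j) * r ^ j)"
    unfolding M by (intro suminf_mult aps_summable[OF g])
  also have "\<dots> \<le> M * N"
    by (intro mult_left_mono aps_suminf_le[OF g] aps_nonneg[OF f])
  finally have 3: "suminf ?M \<le> M * N" .
  have 4: "(\<Sum>j. z ^ j *\<^sub>C prod (f z) (b j)) = prod (f z) (g z)" if z: "norm z \<le> r" for z
    using bounded_linear.sums[OF bounded_bilinear.bounded_linear_right[OF bil, of "f z"]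
        aps_sums[OF g z]]
    by (simp add: hom2[OF z] sums_iff)
  have 5: "(\<lambda>n. \<Sum>j. if n < j then 0 else prod (a (n - j)) (b j))
      = (\<lambda>n. \<Sum>j\<le>n. prod (a (n - j)) (b j))"
  proof
    fix n
    have "(\<Sum>j. if n < j then 0 else prod (a (n - j)) (b j))
        = (\<Sum>j\<le>n. if n < j then 0 else prod (a (n - j)) (b j))"
      by (rule suminf_finite) auto
    then show "(\<Sum>j. if n < j then 0 else prod (a (n - j)) (b j)) = (\<Sum>j\<le>n. prod (a (n - j)) (b j))"
      by simp
  qed
  show ?thesis
    using aps_weaken[OF aps_suminf[OF 1 2] 3 4] unfolding 5 .
qed

lemma aps_mult:
  fixes f g :: "complex \<Rightarrow> 'a::complex_banach_algebra"
  assumes "aps r M a f" "aps r N b g"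
  shows "aps r (M * N) (\<lambda>n. \<Sum>j\<le>n. a (n - j) * b j) (\<lambda>z. f z * g z)"
  using assms
  by (intro aps_prod bounded_bilinear_mult norm_mult_ineq mult_scaleC_left mult_scaleC_right)

lemma aps_power:
  fixes f :: "complex \<Rightarrow> 'a::complex_banach_algebra"
  assumes "aps r M a f"
  shows "\<exists>b. aps r (norm (1::'a) * M ^ n) b (\<lambda>z. f z ^ n)"
proof (induction n)
  case 0
  show ?case using aps_const[of "1::'a"] by auto
next
  case (Suc n)
  then obtain b where "aps r (norm (1::'a) * M ^ n) b (\<lambda>z. f z ^ n)" by blast
  from aps_mult[OF this assms] show ?case
    by (auto simp: power_Suc2 mult.assoc simp del: power_Suc)
qed

text \<open>The powers of \<open>f\<close> have bounds proportional to \<open>K ^ n\<close>, which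
  are summable because \<open>K < 1\<close>.\<close>

lemma aps_binomial_series:
  fixes f :: "complex \<Rightarrow> 'a::complex_banach_algebra"
  assumes f: "aps r K a f" and K: "K < 1" and c: "\<bar>c\<bar> \<le> 1"
  shows "\<exists>M b. aps r M b (\<lambda>z. binomial_series c (f z))"
proof -
  obtain b where b: "\<And>n. aps r (norm (1::'a) * K ^ n) (b n) (\<lambda>z. f z ^ n)"
    using aps_power[OF f] by metis
  have "aps r (1 * (norm (1::'a) * K ^ n)) (\<lambda>k. (c gchoose n) *\<^sub>R b n k)
      (\<lambda>z. (c gchoose n) *\<^sub>R f z ^ n)" for n
  proof (intro aps_linear[OF b] bounded_linear_scaleR_right)
    show "(c gchoose n) *\<^sub>R (d *\<^sub>C x) = d *\<^sub>C (c gchoose n) *\<^sub>R x" for d and x :: 'a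
      by (simp add: scaleR_scaleC scaleC_scaleC mult.commute)
    show "norm ((c gchoose n) *\<^sub>R x) \<le> 1 * norm x" for x :: 'a
      using mult_right_mono[OF abs_gbinomial_le_1[OF c, of n] norm_ge_zero[of x]] by simp
  qed simp
  moreover have "summable (\<lambda>n. 1 * (norm (1::'a) * K ^ n))"
    using K aps_nonneg[OF f] by (intro summable_mult summable_geometric) simp
  ultimately have "aps r (\<Sum>n. 1 * (norm (1::'a) * K ^ n)) (\<lambda>k. \<Sum>n. (c gchoose n) *\<^sub>R b n k)
      (\<lambda>z. binomial_series c (f z))"
    unfolding binomial_series_def by (rule aps_suminf)
  then show ?thesis by blast
qed

end

section \<open>Change of radius and centre; comparison with analytic maps\<close>

lemma aps_smaller:
  assumes "aps r M a f" "0 \<le> r'" "r' \<le> r"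
  shows "aps r' M a f"
  unfolding aps_def
proof (intro conjI allI impI)
  fix N
  have "(\<Sum>n<N. norm (a n) * r' ^ n) \<le> (\<Sum>n<N. norm (a n) * r ^ n)"
    using assms by (intro sum_mono mult_left_mono power_mono) auto
  then show "(\<Sum>n<N. norm (a n) * r' ^ n) \<le> M"
    using aps_bound[OF assms(1)] by (meson order_trans)
qed (use aps_sums[OF assms(1)] assms in auto)

text \<open>Without a constant term every term gains a factor r' / r, so the bound becomes
  arbitrarily small on small discs.\<close>

lemma aps_zero_at_0:
  assumes "aps r M a f" "a 0 = 0" "0 < r'" "r' \<le> r"
  shows "aps r' (r' / r * M) a f"
  unfolding aps_def
proof (intro conjI allI impI)
  fix N
  have *: "norm (a n) * r' ^ n \<le> r' / r * (norm (a n) * r ^ n)" for n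
  proof (cases n)
    case (Suc m)
    have "norm (a n) * (r' * r' ^ m) \<le> norm (a n) * (r' * r ^ m)"
      using assms by (intro mult_left_mono power_mono) auto
    then show ?thesis using assms Suc by (simp add: field_simps)
  qed (simp add: assms)
  have "(\<Sum>n<N. norm (a n) * r' ^ n) \<le> r' / r * (\<Sum>n<N. norm (a n) * r ^ n)"
    unfolding sum_distrib_left by (intro sum_mono *)
  also have "\<dots> \<le> r' / r * M"
    using assms by (intro mult_left_mono aps_bound[OF assms(1)]) auto
  finally show "(\<Sum>n<N. norm (a n) * r' ^ n) \<le> r' / r * M" .
qed (use aps_sums[OF assms(1)] assms in auto)

lemma aps_at_0:
  assumes "aps r M a f" "r \<ge> 0"
  shows "f 0 = a 0"
proof -
  have "(\<lambda>n. 0 ^ n *\<^sub>C a n) sums f 0"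
    using assms by (intro aps_sums) auto
  moreover have "(\<lambda>n. 0 ^ n *\<^sub>C a n) = (\<lambda>n. if n = 0 then a n else 0)"
    by (auto simp: fun_eq_iff zero_power)
  ultimately show ?thesis
    using sums_single[of 0 a] by (metis sums_unique2)
qed

text \<open>Convergence at the radius \<open>s\<close> bounds the terms there; at
  \<open>s / 2\<close> they are dominated by a geometric series of ratio 1/2.\<close>

lemma analytic_map_on_imp_aps:
  fixes f :: "complex \<Rightarrow> 'a::complex_banach"
  assumes "analytic_map_on f U" "0 \<in> U"
  shows "\<exists>r>0. \<exists>M a. aps r M a f"
proof -
  obtain R a where R: "R > 0" and sums: "\<And>w. w \<in> ball 0 R \<Longrightarrow> (\<lambda>n. w ^ n *\<^sub>C a n) sums f w"
    using assms unfolding analytic_map_on_def by force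
  define s where "s = R / 2"
  have s: "s > 0" "s < R" using R by (simp_all add: s_def)
  have "summable (\<lambda>n. complex_of_real s ^ n *\<^sub>C a n)"
    using sums[of "complex_of_real s"] s by (auto simp: sums_iff)
  then have "bounded (range (\<lambda>n. complex_of_real s ^ n *\<^sub>C a n))"
    by (rule summable_imp_bounded)
  then obtain B where "\<And>n. norm (complex_of_real s ^ n *\<^sub>C a n) \<le> B"
    unfolding bounded_iff by blast
  then have B: "norm (a n) * s ^ n \<le> B" for n
    using s by (simp add: norm_scaleC norm_power mult.commute)
  have B0: "B \<ge> 0" using B[of 0] by (simp add: order_trans[OF norm_ge_zero])
  have "(\<Sum>n<N. norm (a n) * (s / 2) ^ n) \<le> B * 2" for N
  proof -
    have "(\<Sum>n<N. norm (a n) * (s / 2) ^ n) = (\<Sum>n<N. (norm (a n) * s ^ n) * (1 / 2) ^ n)"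
      by (simp add: power_divide)
    also have "\<dots> \<le> (\<Sum>n<N. B * (1 / 2) ^ n)"
      by (intro sum_mono mult_right_mono B) auto
    also have "\<dots> = B * (\<Sum>n<N. (1 / 2) ^ n)" by (simp add: sum_distrib_left)
    also have "\<dots> \<le> B * 2"
      by (intro mult_left_mono B0) (simp add: sum_gp_strict)
    finally show ?thesis .
  qed
  moreover have "(\<lambda>n. z ^ n *\<^sub>C a n) sums f z" if "norm z \<le> s / 2" for z
    using that s by (intro sums) auto
  ultimately have "aps (s / 2) (B * 2) a f" unfolding aps_def by blast
  then show ?thesis using s by (intro exI[of _ "s / 2"]) auto
qed

text \<open>On the disc of radius \<open>r - norm z\<close> the map h to z + h has the bound exactly
  \<open>r\<close>. Its powers therefore fit the majorant series of \<open>f\<close>.\<close>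

lemma aps_recentre:
  fixes f :: "complex \<Rightarrow> 'a::complex_banach_algebra"
  assumes f: "aps r M a f" and z: "norm z < r"
  shows "\<exists>M b. aps (r - norm z) M b (\<lambda>h. f (z + h))"
proof -
  have \<rho>: "r - norm z > 0" and r: "r > 0" using z by (auto intro: le_less_trans[OF norm_ge_zero])
  note shift = aps_shift[OF \<rho> aps_const[OF \<rho>, of "1::complex"], of 1]
  have "aps (r - norm z) (norm z + norm (1::complex) * (r - norm z) ^ 1)
      (\<lambda>n. (if n = 0 then z else 0) + (if n < 1 then 0 else if n - 1 = 0 then 1 else 0)) (\<lambda>h. z + h ^ 1 *\<^sub>C 1)"
    by (intro aps_add[OF \<rho> aps_const[OF \<rho>] shift])
  then have "aps (r - norm z) r
      (\<lambda>n. (if n = 0 then z else 0) + (if n < 1 then 0 else if n - 1 = 0 then 1 else 0)) (\<lambda>h. z + h)"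
    by (rule aps_weaken) (auto simp: scaleC_complex_def)
  from aps_power[OF \<rho> this] obtain c
    where c: "\<And>n. aps (r - norm z) (r ^ n) (c n) (\<lambda>h. (z + h) ^ n)"
    by simp metis
  have "aps (r - norm z) (norm (a n) * r ^ n) (\<lambda>k. c n k *\<^sub>C a n) (\<lambda>h. (z + h) ^ n *\<^sub>C a n)" for n
    by (intro aps_linear[OF \<rho> c] bounded_bilinear.bounded_linear_left[OF bounded_bilinear_scaleC])
      (auto simp: scaleC_scaleC scaleC_complex_def norm_scaleC mult.commute)
  from aps_suminf[OF \<rho> this aps_summable[OF r f]]
  have "aps (r - norm z) (\<Sum>n. norm (a n) * r ^ n) (\<lambda>k. \<Sum>n. c n k *\<^sub>C a n) (\<lambda>h. f (z + h))"
  proof (rule aps_weaken)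
    fix h :: complex assume "norm h \<le> r - norm z"
    then have "norm (z + h) \<le> r" using norm_triangle_ineq[of z h] by linarith
    then show "(\<Sum>n. (z + h) ^ n *\<^sub>C a n) = f (z + h)"
      using aps_sums[OF f] by (simp add: sums_iff)
  qed simp
  then show ?thesis by blast
qed

lemma aps_imp_analytic_map_on:
  fixes f :: "complex \<Rightarrow> 'a::complex_banach_algebra"
  assumes "aps r M a f"
  shows "analytic_map_on f (ball 0 r)"
  unfolding analytic_map_on_def
proof
  fix z :: complex assume "z \<in> ball 0 r"
  then have z: "norm z < r" by simp
  then obtain M b where b: "aps (r - norm z) M b (\<lambda>h. f (z + h))"
    using aps_recentre[OF assms] by blast
  have "(\<lambda>n. (w - z) ^ n *\<^sub>C b n) sums f w" if "w \<in> ball z (r - norm z)" for w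
    using aps_sums[OF b, of "w - z"] that by (simp add: dist_norm norm_minus_commute)
  then show "\<exists>\<rho>>0. \<exists>a. \<forall>w\<in>ball z \<rho>. (\<lambda>n. (w - z) ^ n *\<^sub>C a n) sums f w"
    using z by (intro exI[of _ "r - norm z"] conjI exI[of _ b]) auto
qed

subsection \<open>Lifting through an analytic family of operators\<close>

text \<open>The index pairs on the left form a triangle inside the square on the right.\<close>

lemma sum_convolution_le:
  fixes X Y :: "nat \<Rightarrow> real"
  assumes "\<And>n. X n \<ge> 0" "\<And>n. Y n \<ge> 0"
  shows "(\<Sum>n<N. \<Sum>j\<le>n. X (n - j) * Y j) \<le> (\<Sum>n<N. X n) * (\<Sum>n<N. Y n)"
proof -
  have "(\<Sum>n<N. \<Sum>j\<le>n. X (n - j) * Y j) = (\<Sum>(j, i)\<in>{(j, i). j + i < N}. X i * Y j)"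
    by (rule sum.triangle_reindex[symmetric])
  also have "\<dots> \<le> (\<Sum>(j, i)\<in>{..<N} \<times> {..<N}. X i * Y j)"
    using assms by (intro sum_mono2) auto
  also have "\<dots> = (\<Sum>j<N. \<Sum>i<N. Y j * X i)"
    by (simp add: sum.cartesian_product mult.commute)
  also have "\<dots> = (\<Sum>n<N. Y n) * (\<Sum>n<N. X n)"
    by (rule sum_product[symmetric])
  finally show ?thesis by (simp only: mult.commute)
qed

text \<open>Comparing coefficients gives an equation for \<open>p 0\<close> applied to
  \<open>a n\<close> in terms of earlier coefficients, solved with the open mapping constant. On a
  small disc the resulting estimate can be absorbed.\<close>

lemma lift_through_analytic_family:
  fixes \<pi> :: "complex \<Rightarrow> 'a::complex_banach_algebra \<Rightarrow>\<^sub>L 'b::complex_banach_algebra"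
  assumes r: "r > 0" and \<pi>: "aps r P p \<pi>" and u: "aps r Q b u"
    and surj: "surj (blinfun_apply (p 0))" and v0: "blinfun_apply (p 0) v0 = b 0"
    and hom: "\<And>z c y. norm z \<le> r \<Longrightarrow> blinfun_apply (\<pi> z) (c *\<^sub>C y) = c *\<^sub>C blinfun_apply (\<pi> z) y"
  shows "\<exists>s N a v. 0 < s \<and> s \<le> r \<and> aps s N a v \<and> a 0 = v0 \<and>
    (\<forall>z. norm z \<le> s \<longrightarrow> blinfun_apply (\<pi> z) (v z) = u z)"
proof -
  obtain C where C: "C \<ge> 0" "\<And>y. \<exists>x. blinfun_apply (p 0) x = y \<and> norm x \<le> C * norm y"
    using open_mapping_bound[OF blinfun.bounded_linear_right surj] by blast
  have P0: "P \<ge> 0" by (rule aps_nonneg[OF r \<pi>])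
  \<comment> \<open>Chosen to make the recursion contract: \<open>C * (s / r * P)\<close> is at most
    1/2.\<close>
  define K where "K = 2 * (C * P + 1)"
  define s where "s = r / K"
  have CP: "C * P \<ge> 0" using C P0 by simp
  then have K: "K \<ge> 1" by (simp add: K_def)
  then have s: "0 < s" "s \<le> r"
    using r by (simp_all add: s_def divide_le_eq)
  have "C * (s / r * P) = C * P / K"
    using r by (simp add: s_def)
  also have "\<dots> \<le> 1 / 2"
    using K by (simp add: divide_le_eq) (simp add: K_def)
  finally have Cs: "C * (s / r * P) \<le> 1 / 2" .
  define p' where "p' n = (if n = 0 then 0 else p n)" for n
  have "(\<Sum>n<N. norm (p' n) * r ^ n) \<le> P" for N
  proof -
    have "(\<Sum>n<N. norm (p' n) * r ^ n) \<le> (\<Sum>n<N. norm (p n) * r ^ n)"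
      using r by (intro sum_mono mult_right_mono) (auto simp: p'_def)
    then show ?thesis using aps_bound[OF \<pi>] by (meson order_trans)
  qed
  then have "aps s (s / r * P) p' (\<lambda>z. \<Sum>n. z ^ n *\<^sub>C p' n)"
    using s by (intro aps_zero_at_0[OF apsI[OF r]]) (auto simp: p'_def)
  note p'_le = aps_bound[OF this]
  define c where "c f n = b n - (\<Sum>j<n. blinfun_apply (p (n - j)) (f j))" for f n
  \<comment> \<open>The coefficient at 0 is prescribed, so the norm bound is imposed only for
    positive \<open>n\<close>.\<close>
  define R where "R f n x \<longleftrightarrow> blinfun_apply (p 0) x = c f n \<and> (n = 0 \<longrightarrow> x = v0) \<and>
    (n > 0 \<longrightarrow> norm x \<le> C * norm (c f n))" for f n x
  have "\<exists>a. \<forall>n. R a n (a n)"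
  proof (rule dependent_wellorder_choice)
    fix x :: 'a and f g :: "nat \<Rightarrow> 'a" and n :: nat
    assume "\<And>j. j < n \<Longrightarrow> f j = g j"
    then have "c f n = c g n" by (simp add: c_def)
    then show "R f n x = R g n x" by (simp add: R_def)
  next
    fix n :: nat and f :: "nat \<Rightarrow> 'a"
    show "\<exists>x. R f n x"
      using C(2)[of "c f n"] v0 by (cases "n = 0") (auto simp: R_def c_def)
  qed
  then obtain a where a: "\<And>n. R a n (a n)" by blast
  have a_0: "a 0 = v0" using a[of 0] by (simp add: R_def)
  have a_eq: "(\<Sum>j\<le>n. blinfun_apply (p (n - j)) (a j)) = b n" for n
    using a[of n] unfolding lessThan_Suc_atMost[symmetric] sum.lessThan_Suc by (simp add: R_def c_def)
  \<comment> \<open>As \<open>p' 0\<close> vanishes, the sum over all \<open>j\<close> up to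
    \<open>n\<close> is a full convolution that still involves earlier coefficients only.\<close>
  have a_le: "norm (a n) * s ^ n \<le> (if n = 0 then norm v0 else 0) + C * (norm (b n) * s ^ n)
      + C * (\<Sum>j\<le>n. (norm (p' (n - j)) * s ^ (n - j)) * (norm (a j) * s ^ j))" for n
  proof (cases "n = 0")
    case True
    then show ?thesis using C s by (simp add: a_0 p'_def)
  next
    case False
    have sum: "(\<Sum>j<n. norm (p (n - j)) * norm (a j)) * s ^ n
        = (\<Sum>j\<le>n. (norm (p' (n - j)) * s ^ (n - j)) * (norm (a j) * s ^ j))"
    proof -
      have "(\<Sum>j\<le>n. (norm (p' (n - j)) * s ^ (n - j)) * (norm (a j) * s ^ j))
          = (\<Sum>j<n. (norm (p' (n - j)) * s ^ (n - j)) * (norm (a j) * s ^ j))"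
        unfolding lessThan_Suc_atMost[symmetric] sum.lessThan_Suc by (simp add: p'_def)
      also have "\<dots> = (\<Sum>j<n. norm (p (n - j)) * norm (a j) * s ^ n)"
      proof (rule sum.cong[OF refl])
        fix j assume "j \<in> {..<n}"
        then have "s ^ n = s ^ (n - j) * s ^ j" "p' (n - j) = p (n - j)"
          by (simp_all add: power_add[symmetric] p'_def)
        then show "(norm (p' (n - j)) * s ^ (n - j)) * (norm (a j) * s ^ j)
            = norm (p (n - j)) * norm (a j) * s ^ n" by simp
      qed
      finally show ?thesis by (simp add: sum_distrib_right)
    qed
    have "norm (c a n) \<le> norm (b n) + norm (\<Sum>j<n. blinfun_apply (p (n - j)) (a j))"
      unfolding c_def by (rule norm_triangle_ineq4)
    also have "norm (\<Sum>j<n. blinfun_apply (p (n - j)) (a j)) \<le> (\<Sum>j<n. norm (p (n - j)) * norm (a j))"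
      by (intro sum_norm_le norm_blinfun)
    finally have "C * norm (c a n) \<le> C * (norm (b n) + (\<Sum>j<n. norm (p (n - j)) * norm (a j)))"
      using C by (intro mult_left_mono) auto
    then have "norm (a n) \<le> C * (norm (b n) + (\<Sum>j<n. norm (p (n - j)) * norm (a j)))"
      using a[of n] False by (simp add: R_def)
    then have "norm (a n) * s ^ n \<le> C * (norm (b n) + (\<Sum>j<n. norm (p (n - j)) * norm (a j))) * s ^ n"
      using s by (intro mult_right_mono) auto
    also have "\<dots> = C * (norm (b n) * s ^ n) + C * ((\<Sum>j<n. norm (p (n - j)) * norm (a j)) * s ^ n)"
      by (simp only: distrib_left distrib_right mult.assoc)
    finally show ?thesis using False unfolding sum by simp
  qed
  have "(\<Sum>n<N. norm (a n) * s ^ n) \<le> 2 * (norm v0 + C * Q)" for N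
  proof -
    let ?S = "\<Sum>n<N. norm (a n) * s ^ n"
    have "?S \<le> (\<Sum>n<N. (if n = 0 then norm v0 else 0) + C * (norm (b n) * s ^ n)
      + C * (\<Sum>j\<le>n. (norm (p' (n - j)) * s ^ (n - j)) * (norm (a j) * s ^ j)))"
      by (intro sum_mono a_le)
    also have "\<dots> = (\<Sum>n<N. if n = 0 then norm v0 else 0) + C * (\<Sum>n<N. norm (b n) * s ^ n)
      + C * (\<Sum>n<N. \<Sum>j\<le>n. (norm (p' (n - j)) * s ^ (n - j)) * (norm (a j) * s ^ j))"
      by (simp only: sum.distrib sum_distrib_left[symmetric])
    \<comment> \<open>The same finite sum \<open>?S\<close> reappears with the factor 1/2 and is
      absorbed into the left side.\<close>
    also have "\<dots> \<le> norm v0 + C * Q + 1 / 2 * ?S"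
    proof (intro add_mono)
      show "(\<Sum>n<N. if n = 0 then norm v0 else 0) \<le> norm v0"
        by (cases N) (simp_all add: sum.lessThan_Suc_shift del: sum.lessThan_Suc)
      show "C * (\<Sum>n<N. norm (b n) * s ^ n) \<le> C * Q"
        using s by (intro mult_left_mono C aps_bound[OF aps_smaller[OF u]]) auto
      have "C * (\<Sum>n<N. \<Sum>j\<le>n. (norm (p' (n - j)) * s ^ (n - j)) * (norm (a j) * s ^ j))
          \<le> C * ((\<Sum>n<N. norm (p' n) * s ^ n) * ?S)"
        using s by (intro mult_left_mono C sum_convolution_le[of "\<lambda>k. norm (p' k) * s ^ k"]) auto
      also have "\<dots> \<le> C * ((s / r * P) * ?S)"
        using s by (intro mult_left_mono mult_right_mono C p'_le sum_nonneg) auto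
      also have "\<dots> \<le> 1 / 2 * ?S"
        using s mult_right_mono[OF Cs, of ?S] by (simp add: sum_nonneg mult.assoc)
      finally show "C * (\<Sum>n<N. \<Sum>j\<le>n. (norm (p' (n - j)) * s ^ (n - j)) * (norm (a j) * s ^ j))
          \<le> 1 / 2 * ?S" .
    qed
    finally show ?thesis by simp
  qed
  then have v: "aps s (2 * (norm v0 + C * Q)) a (\<lambda>z. \<Sum>n. z ^ n *\<^sub>C a n)"
    by (rule apsI[OF s(1)])
  have "blinfun_apply (\<pi> z) (\<Sum>n. z ^ n *\<^sub>C a n) = u z" if z: "norm z \<le> s" for z
  proof -
    have "norm z \<le> r" using z s by simp
    have "aps s (P * (2 * (norm v0 + C * Q))) (\<lambda>n. \<Sum>j\<le>n. blinfun_apply (p (n - j)) (a j))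
        (\<lambda>z. blinfun_apply (\<pi> z) (\<Sum>n. z ^ n *\<^sub>C a n))"
      using s hom
      by (intro aps_prod[OF s(1) aps_smaller[OF \<pi>] v bounded_bilinear_blinfun_apply norm_blinfun])
        (auto simp: scaleC_blinfun.rep_eq)
    from aps_sums[OF this z] show ?thesis
      unfolding a_eq using aps_sums[OF u \<open>norm z \<le> r\<close>] by (rule sums_unique2)
  qed
  with s v a_0 show ?thesis
    by (intro exI conjI allI impI)
qed

section \<open>Lifting an analytic family of idempotents\<close>

theorem theorem1:
  fixes U :: "complex set"
    and \<pi> :: "complex \<Rightarrow> 'a::complex_banach_algebra \<Rightarrow>\<^sub>L 'b::complex_banach_algebra"
    and q :: "complex \<Rightarrow> 'b"
  assumes "open U" and "0 \<in> U"
    and "analytic_map_on \<pi> U"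
    and "\<And>z. z \<in> U \<Longrightarrow> algebra_hom (blinfun_apply (\<pi> z))"
    and "surj (blinfun_apply (\<pi> 0))"
    and "\<And>x. blinfun_apply (\<pi> 0) x = 0 \<Longrightarrow> connected (- spectrum x)"
    and "analytic_map_on q U"
    and "\<And>z. z \<in> U \<Longrightarrow> q z \<in> idempotents"
  shows "\<exists>V p. open V \<and> 0 \<in> V \<and> V \<subseteq> U \<and> analytic_map_on p V \<and>
    (\<forall>z\<in>V. p z \<in> idempotents \<and> blinfun_apply (\<pi> z) (p z) = q z)"
proof (cases "(1::'b) = 0")
  \<comment> \<open>The zero algebra is allowed as codomain; there the zero idempotent is a
    lift.\<close>
  case True
  have zero: "y = 0" for y :: 'b
    using mult_1_right[of y] unfolding True mult_zero_right by (rule sym)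
  have "blinfun_apply (\<pi> z) 0 = q z" for z
    by (rule trans[OF zero zero[symmetric]])
  moreover have "analytic_map_on (\<lambda>_. 0 :: 'a) U"
    unfolding analytic_map_on_def
    by (intro ballI exI[of _ "1::real"] conjI exI[of _ "\<lambda>_. 0"]) simp_all
  ultimately show ?thesis
    using assms(1,2) by (intro exI[of _ U] exI[of _ "\<lambda>_. 0"]) (auto simp: idempotents_def)
next
  case False
  note hom = assms(4)
  define u where "u z = q z + q z + (- 1)" for z
  obtain r1 P p where r1: "r1 > 0" and p: "aps r1 P p \<pi>"
    using analytic_map_on_imp_aps[OF assms(3,2)] by blast
  obtain r2 M b where r2: "r2 > 0" and b: "aps r2 M b q"
    using analytic_map_on_imp_aps[OF assms(7,2)] by blast
  obtain e where e: "e > 0" "ball 0 e \<subseteq> U"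
    using openE[OF assms(1,2)] by blast
  \<comment> \<open>Half of \<open>e\<close> keeps the closed disc of radius \<open>r\<close> inside
    \<open>U\<close>.\<close>
  define r where "r = min (min r1 r2) (e / 2)"
  have r: "r > 0" "r \<le> r1" "r \<le> r2" "r < e" using r1 r2 e by (auto simp: r_def)
  have in_U: "z \<in> U" if "norm z \<le> r" for z
    using that r e by auto
  have p: "aps r P p \<pi>" and b: "aps r M b q"
    using aps_smaller[OF p] aps_smaller[OF b] r by auto
  from aps_add[OF r(1) aps_add[OF r(1) b b] aps_const[OF r(1), of "-1"]]
  obtain Q d where u: "aps r Q d u"
    unfolding u_def by blast
  have p_0: "p 0 = \<pi> 0" and d_0: "d 0 = u 0"
    using aps_at_0[OF p] aps_at_0[OF u] r by auto
  have u_square: "u z * u z = 1" if "z \<in> U" for z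
    using assms(8)[OF that] by (simp add: u_def idempotents_def algebra_simps)
  have cont: "continuous_on UNIV (blinfun_apply (\<pi> z))" for z
    by (intro continuous_intros)
  obtain v where v: "blinfun_apply (\<pi> 0) v = u 0"
    using assms(5) by (metis surj_def)
  obtain v0 where v0: "blinfun_apply (\<pi> 0) v0 = u 0" "v0 * v0 = 1"
    using lift_involution[OF hom[OF assms(2)] cont False assms(6), of v] u_square[OF assms(2)]
    unfolding v by blast
  have "blinfun_apply (\<pi> z) (c *\<^sub>C y) = c *\<^sub>C blinfun_apply (\<pi> z) y" if "norm z \<le> r" for z c y
    using hom_scaleC[OF hom[OF in_U[OF that]]] .
  then obtain s N a v where s: "0 < s" "s \<le> r" and v: "aps s N a v" and a_0: "a 0 = v0"
    and \<pi>_v: "\<And>z. norm z \<le> s \<Longrightarrow> blinfun_apply (\<pi> z) (v z) = u z"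
    using lift_through_analytic_family[OF r(1) p u, of v0] assms(5) v0(1) unfolding p_0 d_0 by blast
  define y where "y z = v z * v z + (- 1)" for z
  note aps_add[OF s(1) aps_mult[OF s(1) v v] aps_const[OF s(1), of "-1"]]
  \<comment> \<open>The constant coefficient is \<open>v0 * v0 - 1\<close>, which vanishes by the
    choice of \<open>v0\<close>.\<close>
  then obtain L c where y: "aps s L c y" and c_0: "c 0 = 0"
    unfolding y_def by (auto simp: a_0 v0(2))
  have L: "L \<ge> 0" by (rule aps_nonneg[OF s(1) y])
  \<comment> \<open>Shrinking the radius by L + 1 brings the bound for \<open>y\<close> down to L /
    (L + 1), below 1.\<close>
  define t where "t = s / (L + 1)"
  have "t / s * L = L / (L + 1)"
    using s by (simp add: t_def)
  then have t: "0 < t" "t \<le> s" "t / s * L < 1"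
    using s L by (simp_all add: t_def divide_le_eq divide_less_eq)
  have y: "aps t (t / s * L) c y"
    by (rule aps_zero_at_0[OF y c_0 t(1,2)])
  obtain K k where k: "aps t K k (\<lambda>z. binomial_series (- 1 / 2) (y z))"
    using aps_binomial_series[OF t(1) y t(3), of "- 1 / 2"] by auto
  define f where "f z = (1 / 2) *\<^sub>R (1 + v z * binomial_series (- 1 / 2) (y z))" for z
  from aps_add[OF t(1) aps_const[OF t(1), of 1] aps_mult[OF t(1) aps_smaller[OF v] k]]
  obtain F g where F: "aps t F g (\<lambda>z. 1 + v z * binomial_series (- 1 / 2) (y z))"
    using t by auto
  have "aps t (1 / 2 * F) (\<lambda>n. (1 / 2) *\<^sub>R g n) f"
    unfolding f_def
    by (intro aps_linear[OF t(1) F] bounded_linear_scaleR_right)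
      (simp_all add: scaleR_scaleC scaleC_scaleC norm_scaleC mult.commute)
  then have "analytic_map_on f (ball 0 t)"
    by (rule aps_imp_analytic_map_on)
  moreover have "f z \<in> idempotents \<and> blinfun_apply (\<pi> z) (f z) = q z" if "z \<in> ball 0 t" for z
  proof -
    have z: "norm z \<le> t" "norm z \<le> s" "norm z \<le> r" using that t s by auto
    note hom_z = hom[OF in_U[OF z(3)]]
    define S where "S = binomial_series (- 1 / 2) (y z)"
    have f_S: "f z = (1 / 2) *\<^sub>R (1 + v z * S)"
      by (simp only: f_def S_def)
    have y_small: "norm (y z) < 1"
      using aps_norm_le[OF t(1) y z(1)] t(3) by linarith
    \<comment> \<open>Since \<open>1 + y z\<close> is \<open>v z * v z\<close>, the square of
      \<open>S\<close> inverts the square of \<open>v z\<close>.\<close>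
    have "S * S = binomial_series (- 1) (y z)"
      using binomial_series_mult[OF y_small, of "- 1 / 2" "- 1 / 2"] by (simp add: S_def)
    moreover have "(1 + y z) * binomial_series (- 1) (y z) = 1"
      using binomial_series_mult[OF y_small, of 1 "- 1"] by simp
    ultimately have SS: "v z * v z * (S * S) = 1"
      by (simp add: y_def)
    have "v z * y z = y z * v z"
      by (simp add: y_def algebra_simps)
    then have vS: "v z * S = S * v z"
      unfolding S_def by (intro binomial_series_commute[OF y_small]) auto
    have "v z * S * (v z * S) = v z * (S * v z) * S"
      by (simp add: mult.assoc)
    also have "\<dots> = 1"
      using SS by (simp only: vS[symmetric]) (simp add: mult.assoc)
    finally have sq: "v z * S * (v z * S) = 1" .
    have "f z * f z = (1 / 4) *\<^sub>R ((1 + v z * S) * (1 + v z * S))"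
      by (simp add: f_S)
    also have "(1 + v z * S) * (1 + v z * S) = 2 *\<^sub>R (1 + v z * S)"
      by (simp only: distrib_left distrib_right sq mult_1_left mult_1_right scaleR_2) (simp add: add_ac)
    finally have "f z * f z = f z" by (simp add: f_S)
    \<comment> \<open>The homomorphism kills \<open>y z\<close> and so maps \<open>S\<close> to the
      binomial series at 0, which is 1: the correction does not change the image of
      \<open>v z\<close>.\<close>
    moreover have "blinfun_apply (\<pi> z) (y z) = 0"
      by (simp add: y_def hom_simps[OF hom_z] \<pi>_v[OF z(2)] u_square[OF in_U[OF z(3)]])
    then have "blinfun_apply (\<pi> z) S = 1"
      unfolding S_def by (simp add: hom_binomial_series[OF hom_z cont y_small])
    then have "blinfun_apply (\<pi> z) (f z) = (1 / 2) *\<^sub>R (1 + u z)"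
      by (simp add: f_S hom_simps[OF hom_z] \<pi>_v[OF z(2)])
    then have "blinfun_apply (\<pi> z) (f z) = q z"
      by (simp add: u_def scaleR_2[symmetric])
    ultimately show ?thesis by (simp add: idempotents_def)
  qed
  moreover have "ball 0 t \<subseteq> U"
    using t s in_U by auto
  ultimately show ?thesis
    using t(1) by (intro exI[of _ "ball 0 t"] exI[of _ f]) auto
qed

end
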